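(* Let $d\ge1$. Suppose $f\in\mathbb{R}\{x_1,\dots,x_d\}$, $f(0)=0$, and $f(x)>0$ for all sufficiently small $x\in\mathbb{R}^d$, $x\neq0$. Then there exist a positive integer $K$ and a polynomial $g(x_1,\dots,x_d)\in\mathbb{R}[x_1,\dots,x_d]$ such that, for $x\in\mathbb{R}^d$ near $0$, $$g(x)\asymp f(x)\quad\text{and}\quad f(x)\gtrsim|x|^K.$$
   Context: $\mathbb{R}\{x_1,\dots,x_d\}$ is the ring of power series with real coefficients convergent in a neighborhood of $0$. The notation $f\gtrsim g$ means $f(x)\ge Cg(x)$ for all $x$ in some neighborhood of $0$, for some constant $C>0$; $f\asymp g$ means $c f(x)\le g(x)\le Cf(x)$ in some neighborhood of $0$ for some constants $c,C>0$. *)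

theory Defs
  imports "HOL-Analysis.Analysis" "HOL-Library.Poly_Mapping"
begin

text \<open>
  The number of variables is \<open>d = CARD('n)\<close> for a finite (hence nonempty) index type.
  Multi-indices are \<open>'n \<Rightarrow>\<^sub>0 nat\<close>, power series are arbitrary coefficient functions on them,
  and polynomials \<open>('n \<Rightarrow>\<^sub>0 nat) \<Rightarrow>\<^sub>0 real\<close> are the coefficient functions of finite support.
\<close>

type_synonym 'n power_series = "('n \<Rightarrow>\<^sub>0 nat) \<Rightarrow> real"
type_synonym 'n polynomial = "('n \<Rightarrow>\<^sub>0 nat) \<Rightarrow>\<^sub>0 real"

definition monomial_at :: "('n::finite \<Rightarrow>\<^sub>0 nat) \<Rightarrow> real ^ 'n \<Rightarrow> real"
  where "monomial_at \<alpha> x = (\<Prod>i\<in>UNIV. (x $ i) ^ Poly_Mapping.lookup \<alpha> i)"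

text \<open>Unordered (equivalently, absolute) summability of the multi-indexed series.\<close>

definition convergent_near_0 :: "'n::finite power_series \<Rightarrow> bool"
  where "convergent_near_0 f \<longleftrightarrow>
    (\<forall>\<^sub>F x in nhds 0. (\<lambda>\<alpha>. f \<alpha> * monomial_at \<alpha> x) summable_on UNIV)"

definition series_eval :: "'n::finite power_series \<Rightarrow> real ^ 'n \<Rightarrow> real"
  where "series_eval f x = (\<Sum>\<^sub>\<infinity>\<alpha>. f \<alpha> * monomial_at \<alpha> x)"

definition poly_eval :: "'n::finite polynomial \<Rightarrow> real ^ 'n \<Rightarrow> real"
  where "poly_eval g x =
    (\<Sum>\<alpha>\<in>Poly_Mapping.keys g. Poly_Mapping.lookup g \<alpha> * monomial_at \<alpha> x)"

lemma poly_eval_eq_series_eval: "poly_eval g x = series_eval (Poly_Mapping.lookup g) x"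
proof -
  have "series_eval (Poly_Mapping.lookup g) x =
      (\<Sum>\<^sub>\<infinity>\<alpha>\<in>Poly_Mapping.keys g. Poly_Mapping.lookup g \<alpha> * monomial_at \<alpha> x)"
    unfolding series_eval_def by (rule infsum_cong_neutral) (auto simp: in_keys_iff)
  then show ?thesis by (simp add: poly_eval_def)
qed

text \<open>
  Unlike the Landau symbols of the library, the following relations compare signed values,
  not absolute values, and the neighbourhood of \<open>0\<close> includes the point \<open>0\<close> itself.
\<close>

definition gtrsim :: "('a::real_normed_vector \<Rightarrow> real) \<Rightarrow> ('a \<Rightarrow> real) \<Rightarrow> bool"  (infix \<open>\<succsim>\<close> 50)
  where "f \<succsim> g \<longleftrightarrow> (\<exists>C>0. \<forall>\<^sub>F x in nhds 0. f x \<ge> C * g x)"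

definition asymp_eq :: "('a::real_normed_vector \<Rightarrow> real) \<Rightarrow> ('a \<Rightarrow> real) \<Rightarrow> bool"  (infix \<open>\<asymp>\<close> 50)
  where "f \<asymp> g \<longleftrightarrow>
    (\<exists>c>0. \<exists>C>0. \<forall>\<^sub>F x in nhds 0. c * f x \<le> g x \<and> g x \<le> C * f x)"

end

theory Submission
  imports Defs
begin

text \<open>
  Everything follows from the Lojasiewicz inequality \<open>f \<succsim> norm x ^ K\<close> for an isolated zero: the Taylor
  polynomial \<open>g\<close> of \<open>f\<close> of degree \<open>K\<close> differs from \<open>f\<close> by \<open>O(norm x ^ (K + 1))\<close>, which is small
  compared with \<open>f\<close>, so \<open>g \<asymp> f\<close>.

  If the inequality fails for every \<open>K\<close>, there are points \<open>X k \<noteq> 0\<close> tending to \<open>0\<close> such that, with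
  \<open>\<epsilon> k = norm (X k)\<close>, the values \<open>f (X k)\<close> are eventually smaller than every power of \<open>\<epsilon> k\<close>. Call such a
  sequence of values flat, and call a sequence visible if its absolute values are eventually bounded
  below by some power of \<open>\<epsilon> k\<close>.
  The heart of the proof (\<open>zero_near_flat_point\<close>) is that an analytic \<open>F\<close> which is flat along the \<open>X k\<close>
  has, for infinitely many \<open>k\<close>, a true zero within any prescribed power of \<open>\<epsilon> k\<close> of \<open>X k\<close>. For \<open>f\<close> this
  gives zeros \<open>y\<close> with \<open>norm (y - X k) \<le> \<epsilon> k ^ 2 < norm (X k)\<close>, hence \<open>y \<noteq> 0\<close>: a contradiction.

  That statement is proved by induction on the set \<open>S\<close> of variables on which \<open>F\<close> depends. After a
  linear change of variables and Weierstrass preparation (\<open>weierstrass_preparation\<close>), \<open>F\<close> is, up to a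
  nonvanishing factor, a polynomial \<open>P\<close> in one variable \<open>t\<close> whose coefficients are analytic in the
  others. Passing to a finer filter if necessary, choose a polynomial \<open>W\<close> in \<open>t\<close> of least possible
  degree that is flat along the points and has a visible leading coefficient \<open>a\<close>. By minimality its derivative in \<open>t\<close> is visible. Pseudo-division
  of \<open>P\<close> by \<open>W\<close> leaves a remainder whose coefficients are flat, again by minimality
  (\<open>eliminate_variable\<close>). These coefficients do not involve \<open>t\<close>, so by induction they vanish
  simultaneously at points very close to the \<open>X k\<close>. There \<open>W\<close> is still tiny and its derivative is not,
  so a sign change in the direction of \<open>t\<close> gives a real root of \<open>W\<close> (\<open>eventually_move_to_root\<close>);
  since \<open>a \<noteq> 0\<close> at it, \<open>P\<close> and therefore \<open>F\<close> vanish as well.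

  Along an ultrafilter the flat germs would form a prime ideal of the ring of germs, and \<open>W\<close> would be a
  minimal polynomial over the germs in fewer variables. Refining the
  filter replaces the choice of an ultrafilter.
\<close>

section \<open>Monomials and polydiscs\<close>

lemma monomial_at_add: "monomial_at (\<alpha> + \<beta>) x = monomial_at \<alpha> x * monomial_at \<beta> x"
  by (simp add: monomial_at_def lookup_add power_add prod.distrib)

lemma monomial_at_0 [simp]: "monomial_at 0 x = 1"
  by (simp add: monomial_at_def)

lemma monomial_at_single: "monomial_at (Poly_Mapping.single t k) x = (x $ t) ^ k"
proof -
  have "monomial_at (Poly_Mapping.single t k) x = (\<Prod>i\<in>UNIV. if i = t then (x $ t) ^ k else 1)"
    unfolding monomial_at_def by (rule prod.cong) (auto simp: lookup_single when_def)
  then show ?thesis by simp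
qed

lemma monomial_at_nonneg: "(\<And>i. 0 \<le> r $ i) \<Longrightarrow> 0 \<le> monomial_at \<alpha> r"
  by (simp add: monomial_at_def prod_nonneg)

lemma monomial_at_mono:
  "(\<And>i. 0 \<le> r $ i) \<Longrightarrow> (\<And>i. r $ i \<le> s $ i) \<Longrightarrow> monomial_at \<alpha> r \<le> monomial_at \<alpha> s"
  unfolding monomial_at_def by (intro prod_mono) (simp add: power_mono)

lemma monomial_at_cong_on_keys:
  assumes "\<And>i. i \<in> Poly_Mapping.keys \<alpha> \<Longrightarrow> x $ i = y $ i"
  shows "monomial_at \<alpha> x = monomial_at \<alpha> y"
  unfolding monomial_at_def
proof (rule prod.cong[OF refl])
  fix i show "x $ i ^ Poly_Mapping.lookup \<alpha> i = y $ i ^ Poly_Mapping.lookup \<alpha> i"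
    using assms[of i] by (cases "i \<in> Poly_Mapping.keys \<alpha>") (auto simp: in_keys_iff)
qed

definition polydisc :: "real ^ 'n \<Rightarrow> (real ^ 'n) set"
  where "polydisc r = {x. \<forall>i. \<bar>x $ i\<bar> \<le> r $ i}"

lemma abs_monomial_at_le:
  assumes "x \<in> polydisc r"
  shows "\<bar>monomial_at \<alpha> x\<bar> \<le> monomial_at \<alpha> r"
  using assms unfolding monomial_at_def abs_prod polydisc_def
  by (intro prod_mono) (simp add: power_abs power_mono)

lemma polydisc_mono: "(\<And>i. r $ i \<le> s $ i) \<Longrightarrow> polydisc r \<subseteq> polydisc s"
  unfolding polydisc_def by (auto intro: order_trans)

lemma eventually_polydisc:
  fixes r :: "real ^ 'n::finite"
  assumes "\<And>i. 0 < r $ i"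
  shows "\<forall>\<^sub>F x in nhds 0. x \<in> polydisc r"
proof -
  have "((\<lambda>x. \<bar>x $ i\<bar>) \<longlongrightarrow> \<bar>(0::real^'n) $ i\<bar>) (nhds (0::real^'n))" for i
    by (intro tendsto_rabs tendsto_vec_nth filterlim_ident)
  then have "\<forall>\<^sub>F x in nhds (0::real^'n). \<bar>x $ i\<bar> < r $ i" for i
    using assms[of i] by (intro order_tendstoD) auto
  then have "\<forall>\<^sub>F x in nhds (0::real^'n). \<forall>i. \<bar>x $ i\<bar> < r $ i"
    by (simp add: eventually_all_finite)
  then show ?thesis
    by eventually_elim (auto simp: polydisc_def less_imp_le)
qed

section \<open>Power series with a weighted norm\<close>

text \<open>
  \<open>F\<close> is the sum on the closed polydisc of radius \<open>r\<close> of a power series in the variables from \<open>S\<close> whose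
  weighted norm, the sum of the \<open>\<bar>c \<alpha>\<bar> * r ^ \<alpha>\<close>, is at most \<open>B\<close>. Restricting the variables instead of the
  ambient space makes induction on the number of variables possible within one type. Nothing is said
  about \<open>F\<close> outside the polydisc.
\<close>
definition series_on ::
    "real ^ 'n \<Rightarrow> 'n set \<Rightarrow> (real ^ 'n::finite \<Rightarrow> real) \<Rightarrow> real \<Rightarrow> bool"
  where "series_on r S F B \<longleftrightarrow> (\<forall>i. 0 < r $ i) \<and>
    (\<exists>c M. (\<forall>\<alpha>. c \<alpha> \<noteq> 0 \<longrightarrow> Poly_Mapping.keys \<alpha> \<subseteq> S) \<and>
      ((\<lambda>\<alpha>. \<bar>c \<alpha>\<bar> * monomial_at \<alpha> r) has_sum M) UNIV \<and> M \<le> B \<and>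
      (\<forall>x\<in>polydisc r. ((\<lambda>\<alpha>. c \<alpha> * monomial_at \<alpha> x) has_sum F x) UNIV))"

lemma series_onI:
  assumes "\<And>i. 0 < r $ i" "\<And>\<alpha>. c \<alpha> \<noteq> 0 \<Longrightarrow> Poly_Mapping.keys \<alpha> \<subseteq> S"
    "((\<lambda>\<alpha>. \<bar>c \<alpha>\<bar> * monomial_at \<alpha> r) has_sum M) UNIV" "M \<le> B"
    "\<And>x. x \<in> polydisc r \<Longrightarrow> ((\<lambda>\<alpha>. c \<alpha> * monomial_at \<alpha> x) has_sum F x) UNIV"
  shows "series_on r S F B"
  unfolding series_on_def
  by (intro conjI allI impI exI[of _ c] exI[of _ M] ballI) (fact assms)+

lemma series_on_pos: "series_on r S F B \<Longrightarrow> 0 < r $ i"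
  by (simp add: series_on_def)

lemma has_sum_norm_summable:
  fixes f :: "'a \<Rightarrow> real"
  assumes "g summable_on A" "\<And>j. j \<in> A \<Longrightarrow> \<bar>f j\<bar> \<le> g j"
  shows "f summable_on A"
  by (rule abs_summable_summable, rule summable_on_comparison_test[OF assms(1)])
    (use assms(2) in auto)

text \<open>
  Collecting equal monomials does not increase the norm, so any absolutely summable family of
  monomial terms, possibly with repetitions, yields a series. Products, infinite sums and
  the splittings below are all obtained by exhibiting such a family.
\<close>
lemma series_on_family:
  fixes a :: "'j \<Rightarrow> real"
  assumes r: "\<And>i. 0 < r $ i"
    and keys: "\<And>j. j \<in> J \<Longrightarrow> a j \<noteq> 0 \<Longrightarrow> Poly_Mapping.keys (e j) \<subseteq> S"
    and sum: "((\<lambda>j. \<bar>a j\<bar> * monomial_at (e j) r) has_sum M) J" "M \<le> B"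
    and F: "\<And>x. x \<in> polydisc r \<Longrightarrow> ((\<lambda>j. a j * monomial_at (e j) x) has_sum F x) J"
  shows "series_on r S F B"
proof -
  define c where "c \<alpha> = (\<Sum>\<^sub>\<infinity>j\<in>{j\<in>J. e j = \<alpha>}. a j)" for \<alpha>
  have r0: "0 \<le> r $ i" for i using r[of i] by simp
  have mpos: "0 < monomial_at \<alpha> r" for \<alpha>
    unfolding monomial_at_def using r by (simp add: prod_pos)
  let ?T = "Sigma UNIV (\<lambda>\<alpha>. {j\<in>J. e j = \<alpha>})"
  have bij: "bij_betw (\<lambda>j. (e j, j)) J ?T"
    by (rule bij_betwI[where g = snd]) auto
  have reidx: "((\<lambda>p. g (snd p)) has_sum s) ?T" if "(g has_sum s) J" for g :: "'j \<Rightarrow> real" and s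
    using has_sum_reindex_bij_betw[OF bij, of "\<lambda>p. g (snd p)" s] that by simp
  have sum_abs: "(\<lambda>j. \<bar>a j\<bar>) summable_on {j\<in>J. e j = \<alpha>}" for \<alpha>
  proof -
    have "(\<lambda>j. \<bar>a j\<bar> * monomial_at (e j) r) summable_on {j\<in>J. e j = \<alpha>}"
      by (rule summable_on_subset[OF has_sum_imp_summable[OF sum(1)]]) auto
    then have "(\<lambda>j. \<bar>a j\<bar> * monomial_at \<alpha> r) summable_on {j\<in>J. e j = \<alpha>}"
      by (rule summable_on_cong[THEN iffD1, rotated]) auto
    then have "(\<lambda>j. (\<bar>a j\<bar> * monomial_at \<alpha> r) * (1 / monomial_at \<alpha> r)) summable_on {j\<in>J. e j = \<alpha>}"
      by (rule summable_on_cmult_left)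
    then show ?thesis using mpos[of \<alpha>] by (simp add: less_imp_neq[symmetric])
  qed
  have sum_a: "a summable_on {j\<in>J. e j = \<alpha>}" for \<alpha>
    by (rule has_sum_norm_summable[OF sum_abs]) auto
  have c_abs: "\<bar>c \<alpha>\<bar> \<le> (\<Sum>\<^sub>\<infinity>j\<in>{j\<in>J. e j = \<alpha>}. \<bar>a j\<bar>)" for \<alpha>
    unfolding c_def using norm_infsum_bound[of a "{j\<in>J. e j = \<alpha>}"] sum_abs by simp
  have ck: "Poly_Mapping.keys \<alpha> \<subseteq> S" if "c \<alpha> \<noteq> 0" for \<alpha>
  proof (rule ccontr)
    assume *: "\<not> ?thesis"
    have "c \<alpha> = 0" unfolding c_def by (rule infsum_0) (use * keys in blast)
    with that show False by simp
  qed
  have big: "((\<lambda>\<alpha>. (\<Sum>\<^sub>\<infinity>j\<in>{j\<in>J. e j = \<alpha>}. \<bar>a j\<bar>) * monomial_at \<alpha> r) has_sum M) UNIV"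
  proof (rule has_sum_SigmaD[OF reidx[OF sum(1)]])
    fix \<alpha>
    have "((\<lambda>j. \<bar>a j\<bar> * monomial_at \<alpha> r) has_sum (\<Sum>\<^sub>\<infinity>j\<in>{j\<in>J. e j = \<alpha>}. \<bar>a j\<bar>) * monomial_at \<alpha> r) {j\<in>J. e j = \<alpha>}"
      by (intro has_sum_cmult_left has_sum_infsum sum_abs)
    then show "((\<lambda>j. \<bar>a (snd (\<alpha>, j))\<bar> * monomial_at (e (snd (\<alpha>, j))) r) has_sum
        (\<Sum>\<^sub>\<infinity>j\<in>{j\<in>J. e j = \<alpha>}. \<bar>a j\<bar>) * monomial_at \<alpha> r) {j\<in>J. e j = \<alpha>}"
      by (rule has_sum_cong[THEN iffD1, rotated]) auto
  qed
  have c_sum: "(\<lambda>\<alpha>. \<bar>c \<alpha>\<bar> * monomial_at \<alpha> r) summable_on UNIV"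
    by (rule summable_on_comparison_test[OF has_sum_imp_summable[OF big]])
      (auto intro!: mult_right_mono mult_nonneg_nonneg c_abs monomial_at_nonneg r0)
  have le: "infsum (\<lambda>\<alpha>. \<bar>c \<alpha>\<bar> * monomial_at \<alpha> r) UNIV \<le> M"
    by (rule has_sum_mono[OF has_sum_infsum[OF c_sum] big])
      (auto intro!: mult_right_mono c_abs monomial_at_nonneg r0)
  have sums: "((\<lambda>\<alpha>. c \<alpha> * monomial_at \<alpha> x) has_sum F x) UNIV" if x: "x \<in> polydisc r" for x
  proof (rule has_sum_SigmaD[OF reidx[OF F[OF x]]])
    fix \<alpha>
    have "((\<lambda>j. a j * monomial_at \<alpha> x) has_sum c \<alpha> * monomial_at \<alpha> x) {j\<in>J. e j = \<alpha>}"
      unfolding c_def by (intro has_sum_cmult_left has_sum_infsum sum_a)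
    then show "((\<lambda>j. a (snd (\<alpha>, j)) * monomial_at (e (snd (\<alpha>, j))) x) has_sum
        c \<alpha> * monomial_at \<alpha> x) {j\<in>J. e j = \<alpha>}"
      by (rule has_sum_cong[THEN iffD1, rotated]) auto
  qed
  show ?thesis
    by (rule series_onI[OF r ck has_sum_infsum[OF c_sum] order_trans[OF le sum(2)] sums])
qed

lemma series_on_monomial:
  assumes "\<And>i. 0 < r $ i" "Poly_Mapping.keys \<alpha> \<subseteq> S"
  shows "series_on r S (\<lambda>x. k * monomial_at \<alpha> x) (\<bar>k\<bar> * monomial_at \<alpha> r)"
  by (rule series_on_family[where J = "{()}" and a = "\<lambda>_. k" and e = "\<lambda>_. \<alpha>", OF assms(1) _ has_sum_finiteI])
    (use assms in \<open>auto intro: has_sum_finiteI\<close>)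

lemma series_on_const: "(\<And>i. 0 < r $ i) \<Longrightarrow> series_on r S (\<lambda>x. k) \<bar>k\<bar>"
  using series_on_monomial[of r 0 S k] by simp

lemma series_on_mono:
  assumes "series_on r S F B" "\<And>i. 0 < r' $ i" "\<And>i. r' $ i \<le> r $ i" "S \<subseteq> S'" "B \<le> B'"
    "\<And>x. x \<in> polydisc r' \<Longrightarrow> F' x = F x"
  shows "series_on r' S' F' B'"
proof -
  obtain c M where c: "\<And>\<alpha>. c \<alpha> \<noteq> 0 \<Longrightarrow> Poly_Mapping.keys \<alpha> \<subseteq> S"
    "((\<lambda>\<alpha>. \<bar>c \<alpha>\<bar> * monomial_at \<alpha> r) has_sum M) UNIV" "M \<le> B"
    "\<And>x. x\<in>polydisc r \<Longrightarrow> ((\<lambda>\<alpha>. c \<alpha> * monomial_at \<alpha> x) has_sum F x) UNIV"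
    using assms(1) unfolding series_on_def by blast 
  have le: "\<bar>c \<alpha>\<bar> * monomial_at \<alpha> r' \<le> \<bar>c \<alpha>\<bar> * monomial_at \<alpha> r" for \<alpha>
    using assms(2,3) by (intro mult_left_mono monomial_at_mono) (auto intro: less_imp_le)
  have s: "(\<lambda>\<alpha>. \<bar>c \<alpha>\<bar> * monomial_at \<alpha> r') summable_on UNIV"
    by (rule summable_on_comparison_test[OF has_sum_imp_summable[OF c(2)] le])
      (simp add: assms(2) less_imp_le monomial_at_nonneg)
  have "infsum (\<lambda>\<alpha>. \<bar>c \<alpha>\<bar> * monomial_at \<alpha> r') UNIV \<le> B'"
    using has_sum_mono[OF has_sum_infsum[OF s] c(2) le] c(3) assms(5) by simp
  moreover have "((\<lambda>\<alpha>. c \<alpha> * monomial_at \<alpha> x) has_sum F' x) UNIV" if "x \<in> polydisc r'" for x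
    using c(4)[of x] polydisc_mono[of r' r] assms(3,6) that by (metis subsetD)
  moreover have "Poly_Mapping.keys \<alpha> \<subseteq> S'" if "c \<alpha> \<noteq> 0" for \<alpha>
    using c(1)[OF that] assms(4) by blast
  ultimately show ?thesis
    by (intro series_onI[OF assms(2) _ has_sum_infsum[OF s]])
qed

lemma series_on_abs_le:
  assumes "series_on r S F B" "x \<in> polydisc r"
  shows "\<bar>F x\<bar> \<le> B"
proof -
  obtain c M where c: "((\<lambda>\<alpha>. \<bar>c \<alpha>\<bar> * monomial_at \<alpha> r) has_sum M) UNIV" "M \<le> B"
    "((\<lambda>\<alpha>. c \<alpha> * monomial_at \<alpha> x) has_sum F x) UNIV"
    using assms unfolding series_on_def by blast
  have "norm (F x) \<le> M"
    by (rule norm_infsum_le[OF c(3) c(1)])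
      (auto simp: abs_mult intro!: mult_left_mono abs_monomial_at_le assms)
  then show ?thesis using c(2) by simp
qed

lemma polydisc_self: "(\<And>i. 0 < r $ i) \<Longrightarrow> r \<in> polydisc r"
  by (auto simp: polydisc_def less_imp_le)

lemma series_on_nonneg: "series_on r S F B \<Longrightarrow> 0 \<le> B"
  using series_on_abs_le[of r S F B r] polydisc_self[of r] series_on_pos[of r S F B] by fastforce

lemma series_on_depends:
  assumes "series_on r S F B" "x \<in> polydisc r" "y \<in> polydisc r" "\<And>i. i \<in> S \<Longrightarrow> x $ i = y $ i"
  shows "F x = F y"
proof -
  obtain c where c: "\<And>\<alpha>. c \<alpha> \<noteq> 0 \<Longrightarrow> Poly_Mapping.keys \<alpha> \<subseteq> S"
    "((\<lambda>\<alpha>. c \<alpha> * monomial_at \<alpha> x) has_sum F x) UNIV"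
    "((\<lambda>\<alpha>. c \<alpha> * monomial_at \<alpha> y) has_sum F y) UNIV"
    using assms unfolding series_on_def by blast
  have "c \<alpha> * monomial_at \<alpha> x = c \<alpha> * monomial_at \<alpha> y" for \<alpha>
    using c(1)[of \<alpha>] assms(4) monomial_at_cong_on_keys[of \<alpha> x y] by (cases "c \<alpha> = 0") auto
  with c(2) have "((\<lambda>\<alpha>. c \<alpha> * monomial_at \<alpha> y) has_sum F x) UNIV" by simp
  then show ?thesis using c(3) has_sum_unique by blast
qed

text \<open>
  Completeness of the weighted norm.
\<close>
lemma series_on_infsum:
  fixes F :: "'j \<Rightarrow> real ^ 'n::finite \<Rightarrow> real"
  assumes F: "\<And>j. j \<in> J \<Longrightarrow> series_on r S (F j) (b j)"
    and b: "(b has_sum B) J" and r: "\<And>i. 0 < r $ i"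
    and G: "\<And>x. x \<in> polydisc r \<Longrightarrow> ((\<lambda>j. F j x) has_sum G x) J"
  shows "series_on r S G B"
proof -
  have "\<forall>j\<in>J. \<exists>c M. (\<forall>\<alpha>. c \<alpha> \<noteq> 0 \<longrightarrow> Poly_Mapping.keys \<alpha> \<subseteq> S) \<and>
      ((\<lambda>\<alpha>. \<bar>c \<alpha>\<bar> * monomial_at \<alpha> r) has_sum M) UNIV \<and> M \<le> b j \<and>
      (\<forall>x\<in>polydisc r. ((\<lambda>\<alpha>. c \<alpha> * monomial_at \<alpha> x) has_sum F j x) UNIV)"
    using F unfolding series_on_def by blast
  from bchoice[OF this] obtain c where "\<forall>j\<in>J. \<exists>M. (\<forall>\<alpha>. c j \<alpha> \<noteq> 0 \<longrightarrow> Poly_Mapping.keys \<alpha> \<subseteq> S) \<and>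
      ((\<lambda>\<alpha>. \<bar>c j \<alpha>\<bar> * monomial_at \<alpha> r) has_sum M) UNIV \<and> M \<le> b j \<and>
      (\<forall>x\<in>polydisc r. ((\<lambda>\<alpha>. c j \<alpha> * monomial_at \<alpha> x) has_sum F j x) UNIV)" ..
  from bchoice[OF this] obtain M where
    "\<forall>j\<in>J. (\<forall>\<alpha>. c j \<alpha> \<noteq> 0 \<longrightarrow> Poly_Mapping.keys \<alpha> \<subseteq> S) \<and>
      ((\<lambda>\<alpha>. \<bar>c j \<alpha>\<bar> * monomial_at \<alpha> r) has_sum M j) UNIV \<and> M j \<le> b j \<and>
      (\<forall>x\<in>polydisc r. ((\<lambda>\<alpha>. c j \<alpha> * monomial_at \<alpha> x) has_sum F j x) UNIV)" ..
  then have c: "\<And>j \<alpha>. j \<in> J \<Longrightarrow> c j \<alpha> \<noteq> 0 \<Longrightarrow> Poly_Mapping.keys \<alpha> \<subseteq> S"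
    and M: "\<And>j. j \<in> J \<Longrightarrow> ((\<lambda>\<alpha>. \<bar>c j \<alpha>\<bar> * monomial_at \<alpha> r) has_sum M j) UNIV"
    "\<And>j. j \<in> J \<Longrightarrow> M j \<le> b j"
    and cF: "\<And>j x. j \<in> J \<Longrightarrow> x \<in> polydisc r \<Longrightarrow> ((\<lambda>\<alpha>. c j \<alpha> * monomial_at \<alpha> x) has_sum F j x) UNIV"
    by blast+
  have r0: "0 \<le> monomial_at \<alpha> r" for \<alpha> using r by (intro monomial_at_nonneg) (auto intro: less_imp_le)
  have M0: "0 \<le> M j" if "j \<in> J" for j
    by (rule has_sum_nonneg[OF M(1)[OF that]]) (intro mult_nonneg_nonneg abs_ge_zero r0)
  have Ms: "M summable_on J"
    by (rule summable_on_comparison_test[OF has_sum_imp_summable[OF b]]) (use M M0 in auto)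
  let ?T = "Sigma J (\<lambda>_. UNIV :: ('n \<Rightarrow>\<^sub>0 nat) set)"
  let ?a = "\<lambda>p. c (fst p) (snd p)"
  have Ts: "(\<lambda>p. \<bar>?a p\<bar> * monomial_at (snd p) r) summable_on ?T"
    by (rule summable_on_SigmaI[OF _ Ms]) (use M r0 in auto)
  have s1: "((\<lambda>p. \<bar>?a p\<bar> * monomial_at (snd p) r) has_sum infsum M J) ?T"
    by (rule has_sum_SigmaI[OF _ has_sum_infsum[OF Ms] Ts]) (use M in auto)
  have le: "infsum M J \<le> B"
    using has_sum_mono[OF has_sum_infsum[OF Ms] b] M(2) by auto
  show ?thesis
  proof (rule series_on_family[OF r _ s1 le])
    show "Poly_Mapping.keys (snd p) \<subseteq> S" if "p \<in> ?T" "?a p \<noteq> 0" for p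
      using c[of "fst p" "snd p"] that by auto
    fix x assume x: "x \<in> polydisc r"
    show "((\<lambda>p. ?a p * monomial_at (snd p) x) has_sum G x) ?T"
    proof (rule has_sum_SigmaI[OF _ G[OF x]])
      show "(\<lambda>p. ?a p * monomial_at (snd p) x) summable_on ?T"
        by (rule has_sum_norm_summable[OF Ts])
          (auto simp: abs_mult intro!: mult_left_mono abs_monomial_at_le x)
    qed (use cF x in auto)
  qed
qed

lemma series_on_sum:
  assumes "finite J" "\<And>j. j \<in> J \<Longrightarrow> series_on r S (F j) (b j)" "\<And>i. 0 < r $ i"
  shows "series_on r S (\<lambda>x. \<Sum>j\<in>J. F j x) (\<Sum>j\<in>J. b j)"
  by (rule series_on_infsum[where F = F and b = b and J = J]) (use assms in \<open>auto intro: has_sum_finiteI\<close>)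

lemma series_on_add:
  assumes "series_on r S F A" "series_on r S G B"
  shows "series_on r S (\<lambda>x. F x + G x) (A + B)"
  using series_on_sum[of "UNIV :: bool set" r S "\<lambda>b. if b then F else G" "\<lambda>b. if b then A else B"]
    assms series_on_pos[OF assms(1)] by (simp add: UNIV_bool add.commute)

lemma series_on_mult:
  assumes "series_on r S F A" "series_on r S G B"
  shows "series_on r S (\<lambda>x. F x * G x) (A * B)"
proof -
  note r = series_on_pos[OF assms(1)]
  obtain c M where c: "\<And>\<alpha>. c \<alpha> \<noteq> 0 \<Longrightarrow> Poly_Mapping.keys \<alpha> \<subseteq> S"
    "((\<lambda>\<alpha>. \<bar>c \<alpha>\<bar> * monomial_at \<alpha> r) has_sum M) UNIV" "M \<le> A"
    "\<And>x. x\<in>polydisc r \<Longrightarrow> ((\<lambda>\<alpha>. c \<alpha> * monomial_at \<alpha> x) has_sum F x) UNIV"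
    using assms(1) unfolding series_on_def by blast 
  obtain d N where d: "\<And>\<alpha>. d \<alpha> \<noteq> 0 \<Longrightarrow> Poly_Mapping.keys \<alpha> \<subseteq> S"
    "((\<lambda>\<alpha>. \<bar>d \<alpha>\<bar> * monomial_at \<alpha> r) has_sum N) UNIV" "N \<le> B"
    "\<And>x. x\<in>polydisc r \<Longrightarrow> ((\<lambda>\<alpha>. d \<alpha> * monomial_at \<alpha> x) has_sum G x) UNIV"
    using assms(2) unfolding series_on_def by blast
  have r0: "0 \<le> monomial_at \<alpha> r" for \<alpha> using r by (intro monomial_at_nonneg) (auto intro: less_imp_le)
  let ?a = "\<lambda>p. c (fst p) * d (snd p)" and ?e = "\<lambda>p::(_\<times>_). fst p + snd p"
  let ?T = "Sigma UNIV (\<lambda>_. UNIV :: ('a \<Rightarrow>\<^sub>0 nat) set) :: (('a \<Rightarrow>\<^sub>0 nat) \<times> _) set"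
  have inner: "((\<lambda>\<beta>. \<bar>?a (\<alpha>, \<beta>)\<bar> * monomial_at (?e (\<alpha>, \<beta>)) r) has_sum (\<bar>c \<alpha>\<bar> * monomial_at \<alpha> r) * N) UNIV" for \<alpha>
    using has_sum_cmult_right[OF d(2), of "\<bar>c \<alpha>\<bar> * monomial_at \<alpha> r"]
    by (simp add: abs_mult monomial_at_add algebra_simps)
  have outer: "((\<lambda>\<alpha>. (\<bar>c \<alpha>\<bar> * monomial_at \<alpha> r) * N) has_sum M * N) UNIV"
    by (rule has_sum_cmult_left[OF c(2)])
  have Ts: "(\<lambda>p. \<bar>?a p\<bar> * monomial_at (?e p) r) summable_on ?T"
    by (rule summable_on_SigmaI[OF inner has_sum_imp_summable[OF outer]]) (intro mult_nonneg_nonneg abs_ge_zero r0)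
  have s1: "((\<lambda>p. \<bar>?a p\<bar> * monomial_at (?e p) r) has_sum M * N) ?T"
    by (rule has_sum_SigmaI[OF inner outer Ts])
  have "0 \<le> N" by (rule has_sum_nonneg[OF d(2)]) (intro mult_nonneg_nonneg abs_ge_zero r0)
  have le: "M * N \<le> A * B"
    using c(3) d(3) \<open>0 \<le> N\<close> series_on_nonneg[OF assms(1)] by (intro mult_mono) auto
  show ?thesis
  proof (rule series_on_family[OF r _ s1 le])
    show "Poly_Mapping.keys (?e p) \<subseteq> S" if "p \<in> ?T" "?a p \<noteq> 0" for p
      using c(1)[of "fst p"] d(1)[of "snd p"] that keys_add[of "fst p" "snd p"] by fastforce
    fix x assume x: "x \<in> polydisc r"
    show "((\<lambda>p. ?a p * monomial_at (?e p) x) has_sum F x * G x) ?T"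
    proof (rule has_sum_SigmaI)
      show "(\<lambda>p. ?a p * monomial_at (?e p) x) summable_on ?T"
        by (rule has_sum_norm_summable[OF Ts])
          (auto simp: abs_mult[of _ "monomial_at _ _"] intro!: mult_left_mono abs_monomial_at_le x)
      show "((\<lambda>\<beta>. ?a (\<alpha>, \<beta>) * monomial_at (?e (\<alpha>, \<beta>)) x) has_sum (c \<alpha> * monomial_at \<alpha> x) * G x) UNIV" for \<alpha>
        using has_sum_cmult_right[OF d(4)[OF x], of "c \<alpha> * monomial_at \<alpha> x"]
        by (simp add: monomial_at_add algebra_simps)
      show "((\<lambda>\<alpha>. (c \<alpha> * monomial_at \<alpha> x) * G x) has_sum F x * G x) UNIV"
        by (rule has_sum_cmult_left[OF c(4)[OF x]])
    qed
  qed
qed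

lemma series_on_cmult: "series_on r S F B \<Longrightarrow> series_on r S (\<lambda>x. k * F x) (\<bar>k\<bar> * B)"
  by (rule series_on_mult[OF series_on_const]) (auto intro: series_on_pos)

lemma series_on_coord:
  assumes "\<And>i. 0 < r $ i" "i \<in> S"
  shows "series_on r S (\<lambda>x. x $ i) (r $ i)"
  using series_on_monomial[of r "Poly_Mapping.single i 1" S 1] assms by (simp add: monomial_at_single)

lemma series_on_power:
  assumes "series_on r S F B"
  shows "series_on r S (\<lambda>x. F x ^ n) (B ^ n)"
proof (induction n)
  case 0
  then show ?case using series_on_const[of r S 1] series_on_pos[OF assms] by simp
next
  case (Suc n)
  then show ?case using series_on_mult[OF assms Suc] by simp
qed

lemma series_on_prod:
  assumes "finite I" "\<And>i. i \<in> I \<Longrightarrow> series_on r S (F i) (b i)" "\<And>i. 0 < r $ i"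
  shows "series_on r S (\<lambda>x. \<Prod>i\<in>I. F i x) (\<Prod>i\<in>I. b i)"
  using assms(1,2)
proof (induction I rule: finite_induct)
  case empty
  then show ?case using series_on_const[of r S 1] assms(3) by simp
next
  case (insert i I)
  then show ?case using series_on_mult[of r S "F i" "b i" "\<lambda>x. \<Prod>i\<in>I. F i x" "\<Prod>i\<in>I. b i"] by simp
qed

text \<open>
  On half the polydisc a monomial of degree \<open>n\<close> loses a factor \<open>2 ^ n\<close> against the weight of its
  coefficient, which pays for the factor \<open>n\<close> of its derivative.
\<close>
lemma series_on_lipschitz:
  assumes "series_on r S F B"
  shows "\<exists>L\<ge>0. \<forall>x\<in>polydisc ((1/2) *\<^sub>R r). \<forall>y\<in>polydisc ((1/2) *\<^sub>R r). \<bar>F x - F y\<bar> \<le> L * norm (x - y)"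
proof -
  note r = series_on_pos[OF assms]
  obtain c M where c: "((\<lambda>\<alpha>. \<bar>c \<alpha>\<bar> * monomial_at \<alpha> r) has_sum M) UNIV" "M \<le> B"
    "\<And>x. x\<in>polydisc r \<Longrightarrow> ((\<lambda>\<alpha>. c \<alpha> * monomial_at \<alpha> x) has_sum F x) UNIV"
    using assms unfolding series_on_def by blast
  define s where "s = (1/2) *\<^sub>R r"
  have s: "0 < s $ i" "r $ i = 2 * s $ i" for i using r[of i] by (auto simp: s_def)
  define K where "K = (\<Sum>i\<in>UNIV. 1 / s $ i)"
  have K0: "0 \<le> K" unfolding K_def using s by (intro sum_nonneg) (auto intro: less_imp_le)
  have M0: "0 \<le> M"
    by (rule has_sum_nonneg[OF c(1)]) (intro mult_nonneg_nonneg abs_ge_zero monomial_at_nonneg less_imp_le r)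
  have mono_diff: "\<bar>monomial_at \<alpha> x - monomial_at \<alpha> y\<bar> \<le> monomial_at \<alpha> r * (K * norm (x - y))"
    if x: "x \<in> polydisc s" and y: "y \<in> polydisc s" for \<alpha> x y
  proof -
    let ?l = "Poly_Mapping.lookup \<alpha>"
    have unit: "\<bar>z $ i / s $ i\<bar> \<le> 1" if "z \<in> polydisc s" for z i
      using that s(1)[of i] by (auto simp: polydisc_def divide_simps abs_mult)
    have fac: "monomial_at \<alpha> z = monomial_at \<alpha> s * (\<Prod>i\<in>UNIV. (z $ i / s $ i) ^ ?l i)" for z
      unfolding monomial_at_def prod.distrib[symmetric]
      using s(1) by (intro prod.cong refl) (simp add: power_divide less_imp_neq[symmetric])
    have ms: "0 \<le> monomial_at \<alpha> s" by (rule monomial_at_nonneg) (use s in \<open>auto intro: less_imp_le\<close>)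
    have half: "real (?l i) * monomial_at \<alpha> s \<le> monomial_at \<alpha> r" for i
    proof -
      have "real (?l i) \<le> 2 ^ ?l i" using of_nat_less_two_power[of "?l i"] by (simp add: less_imp_le)
      also have "\<dots> \<le> (\<Prod>j\<in>UNIV. 2 ^ ?l j)"
        using prod_mono[of UNIV "\<lambda>j. if j = i then 2 ^ ?l i else (1::real)" "\<lambda>j. 2 ^ ?l j"] by simp
      finally have "real (?l i) * monomial_at \<alpha> s \<le> (\<Prod>j\<in>UNIV. 2 ^ ?l j) * monomial_at \<alpha> s"
        using ms by (rule mult_right_mono)
      also have "\<dots> = monomial_at \<alpha> r"
        unfolding monomial_at_def prod.distrib[symmetric] s(2) by (simp add: power_mult_distrib)
      finally show ?thesis .
    qed
    have "\<bar>(\<Prod>i\<in>UNIV. (x $ i / s $ i) ^ ?l i) - (\<Prod>i\<in>UNIV. (y $ i / s $ i) ^ ?l i)\<bar>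
        \<le> (\<Sum>i\<in>UNIV. \<bar>(x $ i / s $ i) ^ ?l i - (y $ i / s $ i) ^ ?l i\<bar>)"
      using norm_prod_diff[of UNIV "\<lambda>i. (x $ i / s $ i) ^ ?l i" "\<lambda>i. (y $ i / s $ i) ^ ?l i"]
        unit[OF x] unit[OF y] by (simp add: power_abs power_le_one)
    also have "\<dots> \<le> (\<Sum>i\<in>UNIV. real (?l i) * (norm (x - y) / s $ i))"
    proof (rule sum_mono)
      fix i
      have "\<bar>(x $ i / s $ i) ^ ?l i - (y $ i / s $ i) ^ ?l i\<bar> \<le> real (?l i) * \<bar>x $ i / s $ i - y $ i / s $ i\<bar>"
        using norm_power_diff[of "x $ i / s $ i" "y $ i / s $ i" "?l i"] unit[OF x] unit[OF y] by simp
      also have "\<bar>x $ i / s $ i - y $ i / s $ i\<bar> = \<bar>(x - y) $ i\<bar> / s $ i"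
        using s(1)[of i] by (simp add: diff_divide_distrib[symmetric])
      also have "\<dots> \<le> norm (x - y) / s $ i"
        using s(1)[of i] component_le_norm_cart[of "x - y" i] by (intro divide_right_mono) auto
      finally show "\<bar>(x $ i / s $ i) ^ ?l i - (y $ i / s $ i) ^ ?l i\<bar> \<le> real (?l i) * (norm (x - y) / s $ i)"
        by (simp add: mult_left_mono)
    qed
    finally have "\<bar>monomial_at \<alpha> x - monomial_at \<alpha> y\<bar>
        \<le> monomial_at \<alpha> s * (\<Sum>i\<in>UNIV. real (?l i) * (norm (x - y) / s $ i))"
      unfolding fac[of x] fac[of y] right_diff_distrib[symmetric] abs_mult
      using ms by (simp add: mult_left_mono)
    also have "\<dots> = (\<Sum>i\<in>UNIV. (real (?l i) * monomial_at \<alpha> s) * (norm (x - y) / s $ i))"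
      by (simp add: sum_distrib_left mult_ac)
    also have "\<dots> \<le> (\<Sum>i\<in>UNIV. monomial_at \<alpha> r * (norm (x - y) / s $ i))"
      using half s(1) by (intro sum_mono mult_right_mono divide_nonneg_pos norm_ge_zero) auto
    also have "\<dots> = monomial_at \<alpha> r * (K * norm (x - y))"
      by (simp add: K_def sum_distrib_left sum_distrib_right mult_ac)
    finally show ?thesis .
  qed
  have "\<bar>F x - F y\<bar> \<le> (M * K) * norm (x - y)" if x: "x \<in> polydisc s" and y: "y \<in> polydisc s" for x y
  proof -
    have sub: "polydisc s \<subseteq> polydisc r" using s by (intro polydisc_mono) (auto intro: less_imp_le)
    have "((\<lambda>\<alpha>. c \<alpha> * monomial_at \<alpha> x + - (c \<alpha> * monomial_at \<alpha> y)) has_sum F x + - F y) UNIV"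
      using c(3) x y sub by (intro has_sum_add has_sum_uminusI) auto
    moreover have "((\<lambda>\<alpha>. (\<bar>c \<alpha>\<bar> * monomial_at \<alpha> r) * (K * norm (x - y))) has_sum M * (K * norm (x - y))) UNIV"
      by (rule has_sum_cmult_left[OF c(1)])
    ultimately have "norm (F x + - F y) \<le> M * (K * norm (x - y))"
    proof (rule norm_infsum_le)
      fix \<alpha>
      have "c \<alpha> * monomial_at \<alpha> x + - (c \<alpha> * monomial_at \<alpha> y) = c \<alpha> * (monomial_at \<alpha> x - monomial_at \<alpha> y)"
        by (simp add: algebra_simps)
      then show "norm (c \<alpha> * monomial_at \<alpha> x + - (c \<alpha> * monomial_at \<alpha> y)) \<le> (\<bar>c \<alpha>\<bar> * monomial_at \<alpha> r) * (K * norm (x - y))"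
        using mult_left_mono[OF mono_diff[OF x y, of \<alpha>], of "\<bar>c \<alpha>\<bar>"] by (simp add: abs_mult mult_ac)
    qed
    then show ?thesis by (simp add: mult_ac)
  qed
  then show ?thesis using K0 M0 unfolding s_def by (intro exI[of _ "M * K"]) auto
qed

section \<open>Weierstrass preparation\<close>

lemma series_on_split_linear:
  assumes "series_on r S F B"
  shows "\<exists>F0 F1. series_on r (S - {t}) F0 B \<and> series_on r S F1 (B / r $ t) \<and>
    (\<forall>x\<in>polydisc r. F x = F0 x + x $ t * F1 x)"
proof -
  note r = series_on_pos[OF assms]
  obtain c M where c: "\<And>\<alpha>. c \<alpha> \<noteq> 0 \<Longrightarrow> Poly_Mapping.keys \<alpha> \<subseteq> S"
    "((\<lambda>\<alpha>. \<bar>c \<alpha>\<bar> * monomial_at \<alpha> r) has_sum M) UNIV" "M \<le> B"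
    "\<And>x. x\<in>polydisc r \<Longrightarrow> ((\<lambda>\<alpha>. c \<alpha> * monomial_at \<alpha> x) has_sum F x) UNIV"
    using assms unfolding series_on_def by blast
  have m0: "0 \<le> monomial_at \<alpha> r" for \<alpha> using r by (intro monomial_at_nonneg less_imp_le)
  define J where "J = {\<alpha>::'a \<Rightarrow>\<^sub>0 nat. Poly_Mapping.lookup \<alpha> t = 0}"
  define e where "e \<alpha> = \<alpha> - Poly_Mapping.single t (1::nat)" for \<alpha> :: "'a \<Rightarrow>\<^sub>0 nat"
  have e: "\<alpha> = e \<alpha> + Poly_Mapping.single t 1" if "\<alpha> \<in> - J" for \<alpha>
    by (rule poly_mapping_eqI) (use that in \<open>auto simp: J_def e_def lookup_add lookup_minus lookup_single when_def\<close>)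
  have em: "monomial_at \<alpha> x = x $ t * monomial_at (e \<alpha>) x" if "\<alpha> \<in> - J" for \<alpha> x
    by (subst e[OF that]) (simp add: monomial_at_add monomial_at_single del: One_nat_def)
  have ek: "Poly_Mapping.keys (e \<alpha>) \<subseteq> Poly_Mapping.keys \<alpha>" for \<alpha>
    by (auto simp: e_def in_keys_iff lookup_minus)
  have absF: "(\<lambda>\<alpha>. c \<alpha> * monomial_at \<alpha> x) summable_on A" if "x \<in> polydisc r" for x A
    by (rule summable_on_subset[OF has_sum_imp_summable[OF c(4)[OF that]]]) auto
  have absM: "(\<lambda>\<alpha>. \<bar>c \<alpha>\<bar> * monomial_at \<alpha> r) summable_on A" for A
    by (rule summable_on_subset[OF has_sum_imp_summable[OF c(2)]]) auto
  have MA: "infsum (\<lambda>\<alpha>. \<bar>c \<alpha>\<bar> * monomial_at \<alpha> r) A \<le> B" for A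
    by (rule order_trans[OF has_sum_mono'[OF has_sum_infsum[OF absM] c(2)] c(3)])
      (auto intro: mult_nonneg_nonneg m0)
  have F0: "series_on r (S - {t}) (\<lambda>x. \<Sum>\<^sub>\<infinity>\<alpha>\<in>J. c \<alpha> * monomial_at \<alpha> x) B"
  proof (rule series_on_family[OF r _ has_sum_infsum[OF absM] MA has_sum_infsum[OF absF]])
    show "Poly_Mapping.keys \<alpha> \<subseteq> S - {t}" if "\<alpha> \<in> J" "c \<alpha> \<noteq> 0" for \<alpha>
      using c(1) that by (auto simp: J_def in_keys_iff)
  qed
  have sum1: "((\<lambda>\<alpha>. \<bar>c \<alpha>\<bar> * monomial_at (e \<alpha>) r) has_sum infsum (\<lambda>\<alpha>. \<bar>c \<alpha>\<bar> * monomial_at \<alpha> r) (- J) * (1 / r $ t)) (- J)"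
    by (rule has_sum_cong[THEN iffD1, OF _ has_sum_cmult_left[OF has_sum_infsum[OF absM]]])
      (use r[of t] in \<open>auto simp: em\<close>)
  have F1: "series_on r S (\<lambda>x. \<Sum>\<^sub>\<infinity>\<alpha>\<in>-J. c \<alpha> * monomial_at (e \<alpha>) x) (B / r $ t)"
  proof (rule series_on_family[OF r _ sum1])
    show "Poly_Mapping.keys (e \<alpha>) \<subseteq> S" if "\<alpha> \<in> - J" "c \<alpha> \<noteq> 0" for \<alpha>
      using c(1)[OF that(2)] ek by blast
    show "infsum (\<lambda>\<alpha>. \<bar>c \<alpha>\<bar> * monomial_at \<alpha> r) (- J) * (1 / r $ t) \<le> B / r $ t"
      using MA[of "- J"] r[of t] by (simp add: divide_right_mono)
  qed (auto intro!: has_sum_infsum has_sum_norm_summable[OF has_sum_imp_summable[OF sum1]]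
      simp: abs_mult mult_left_mono abs_monomial_at_le)
  have "F x = (\<Sum>\<^sub>\<infinity>\<alpha>\<in>J. c \<alpha> * monomial_at \<alpha> x) + x $ t * (\<Sum>\<^sub>\<infinity>\<alpha>\<in>-J. c \<alpha> * monomial_at (e \<alpha>) x)"
    if x: "x \<in> polydisc r" for x
  proof -
    have "F x = infsum (\<lambda>\<alpha>. c \<alpha> * monomial_at \<alpha> x) (J \<union> - J)"
      using c(4)[OF x] by (simp add: infsumI)
    also have "\<dots> = infsum (\<lambda>\<alpha>. c \<alpha> * monomial_at \<alpha> x) J + infsum (\<lambda>\<alpha>. c \<alpha> * monomial_at \<alpha> x) (- J)"
      by (rule infsum_Un_disjoint) (auto intro: absF x)
    also have "infsum (\<lambda>\<alpha>. c \<alpha> * monomial_at \<alpha> x) (- J) = infsum (\<lambda>\<alpha>. x $ t * (c \<alpha> * monomial_at (e \<alpha>) x)) (- J)"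
      by (rule infsum_cong) (simp add: em)
    also have "\<dots> = x $ t * infsum (\<lambda>\<alpha>. c \<alpha> * monomial_at (e \<alpha>) x) (- J)"
      by (rule infsum_cmult_right')
    finally show ?thesis .
  qed
  then show ?thesis using F0 F1 by blast
qed

text \<open>
  Division with remainder by the power \<open>x $ t ^ p\<close>. The quotient gains the factor \<open>1 / r $ t ^ p\<close>, which
  makes the iteration below contract.
\<close>
lemma series_on_split:
  assumes "series_on r S F B"
  shows "\<exists>G s. series_on r S G (B / r $ t ^ p) \<and> (\<forall>k<p. series_on r (S - {t}) (s k) (B / r $ t ^ k)) \<and>
    (\<forall>x\<in>polydisc r. F x = x $ t ^ p * G x + (\<Sum>k<p. s k x * x $ t ^ k))"
proof (induction p)
  case 0
  then show ?case using assms by (intro exI[of _ F]) auto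
next
  case (Suc p)
  then obtain G s where G: "series_on r S G (B / r $ t ^ p)" and
    s: "\<forall>k<p. series_on r (S - {t}) (s k) (B / r $ t ^ k)" and
    F: "\<forall>x\<in>polydisc r. F x = x $ t ^ p * G x + (\<Sum>k<p. s k x * x $ t ^ k)" by blast
  from series_on_split_linear[OF G, of t] obtain G0 G1 where
    G0: "series_on r (S - {t}) G0 (B / r $ t ^ p)" and G1: "series_on r S G1 (B / r $ t ^ p / r $ t)"
    and GG: "\<forall>x\<in>polydisc r. G x = G0 x + x $ t * G1 x" by blast
  have "F x = x $ t ^ Suc p * G1 x + (\<Sum>k<Suc p. (s(p := G0)) k x * x $ t ^ k)" if "x \<in> polydisc r" for x
  proof -
    have "(\<Sum>k<p. (s(p := G0)) k x * x $ t ^ k) = (\<Sum>k<p. s k x * x $ t ^ k)"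
      by (rule sum.cong) auto
    then show ?thesis using F GG that by (simp add: algebra_simps)
  qed
  moreover have "series_on r S G1 (B / r $ t ^ Suc p)" using G1 by (simp add: mult.commute)
  moreover have "\<forall>k<Suc p. series_on r (S - {t}) ((s(p := G0)) k) (B / r $ t ^ k)"
    using s G0 by (auto simp: less_Suc_eq)
  ultimately show ?case by blast
qed

text \<open>
  A small perturbation \<open>x $ t ^ p + g\<close> of a pure power becomes a polynomial in \<open>x $ t\<close> when multiplied by a
  suitable \<open>v\<close>. The factor is a Neumann series \<open>v = V 0 + V 1 + \<dots>\<close> with \<open>V 0 = 1\<close>: dividing
  \<open>V n * g\<close> by \<open>x $ t ^ p\<close> gives the quotient \<open>- V (n + 1)\<close> and a remainder of degree less than \<open>p\<close>, so the
  sum over \<open>n\<close> telescopes to \<open>v * g = - x $ t ^ p * (v - 1)\<close> plus the remainders. The norms decrease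
  like \<open>1 / 4 ^ n\<close>, hence \<open>\<bar>v - 1\<bar> \<le> 1/3\<close> and \<open>v\<close> does not vanish.
\<close>
lemma weierstrass_iteration:
  assumes g: "series_on r S g C" and C: "C \<le> r $ t ^ p / 4"
  shows "\<exists>v s. series_on r S v (4/3) \<and> (\<forall>k<p. \<exists>B. series_on r (S - {t}) (s k) B) \<and>
    (\<forall>x\<in>polydisc r. v x \<noteq> 0 \<and> v x * (x $ t ^ p + g x) = x $ t ^ p + (\<Sum>k<p. s k x * x $ t ^ k))"
proof -
  note r = series_on_pos[OF g]
  define Q where "Q V V' \<sigma> \<longleftrightarrow> (\<forall>x\<in>polydisc r. V x * g x = - (x $ t ^ p * V' x) + (\<Sum>k<p. \<sigma> k x * x $ t ^ k))"
    for V V' :: "real ^ 'a \<Rightarrow> real" and \<sigma>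
  let ?P = "\<lambda>n V. series_on r S V ((1/4) ^ n) \<and> (n = 0 \<longrightarrow> V = (\<lambda>_. 1))"
  let ?R = "\<lambda>n V V'. \<exists>\<sigma>. (\<forall>k<p. series_on r (S - {t}) (\<sigma> k) ((1/4) ^ n * (C / r $ t ^ k))) \<and> Q V V' \<sigma>"
  have step: "\<exists>V'. ?P (Suc n) V' \<and> ?R n V V'" if V: "?P n V" for n V
  proof -
    from V have "series_on r S (\<lambda>x. V x * g x) ((1/4) ^ n * C)" using series_on_mult g by blast
    from series_on_split[OF this, of t p] obtain G \<sigma> where
      G: "series_on r S G ((1/4) ^ n * C / r $ t ^ p)" and
      \<sigma>: "\<forall>k<p. series_on r (S - {t}) (\<sigma> k) ((1/4) ^ n * C / r $ t ^ k)" and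
      eq: "\<forall>x\<in>polydisc r. V x * g x = x $ t ^ p * G x + (\<Sum>k<p. \<sigma> k x * x $ t ^ k)" by blast
    have "C / r $ t ^ p \<le> 1/4" using C r[of t] by (simp add: divide_simps mult.commute)
    then have "(1/4) ^ n * (C / r $ t ^ p) \<le> (1/4) ^ n * (1/4)" by (rule mult_left_mono) simp
    then have le: "\<bar>-1\<bar> * ((1/4) ^ n * C / r $ t ^ p) \<le> (1/4) ^ Suc n" by simp
    have "series_on r S (\<lambda>x. - G x) ((1/4) ^ Suc n)"
      by (rule series_on_mono[OF series_on_cmult[OF G, of "-1"] r order_refl subset_refl le]) simp
    moreover have "Q V (\<lambda>x. - G x) \<sigma>" using eq by (simp add: Q_def)
    ultimately show ?thesis using \<sigma> by (intro exI[of _ "\<lambda>x. - G x"]) auto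
  qed
  have "\<exists>V. ?P 0 V" using series_on_const[of r S 1] r by auto
  from dependent_nat_choice[of ?P ?R, OF this step]
  obtain V where V': "\<forall>n. ?P n (V n) \<and> ?R n (V n) (V (Suc n))" ..
  then have V: "?P n (V n)" "?R n (V n) (V (Suc n))" for n by blast+
  from V(2) obtain \<sigma> where \<sigma>: "\<And>n k. k < p \<Longrightarrow> series_on r (S - {t}) (\<sigma> n k) ((1/4) ^ n * (C / r $ t ^ k))"
    and Q: "\<And>n. Q (V n) (V (Suc n)) (\<sigma> n)"
    by metis
  have geo: "((\<lambda>n. (1/4::real) ^ n) has_sum 4/3) UNIV"
    using geometric_sums[of "1/4::real"] by (intro sums_nonneg_imp_has_sum) auto
  have geoC: "((\<lambda>n. (1/4::real) ^ n * K) has_sum 4/3 * K) UNIV" for K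
    by (rule has_sum_cmult_left[OF geo])
  have Vs: "((\<lambda>n. V n x) has_sum (\<Sum>\<^sub>\<infinity>n. V n x)) UNIV" if "x \<in> polydisc r" for x
    by (rule has_sum_infsum, rule has_sum_norm_summable[OF has_sum_imp_summable[OF geo]])
      (use V(1) that series_on_abs_le in blast)
  have \<sigma>s: "((\<lambda>n. \<sigma> n k x) has_sum (\<Sum>\<^sub>\<infinity>n. \<sigma> n k x)) UNIV" if "x \<in> polydisc r" "k < p" for x k
    by (rule has_sum_infsum, rule has_sum_norm_summable[OF has_sum_imp_summable[OF geoC[of "C / r $ t ^ k"]]])
      (use \<sigma> that series_on_abs_le in blast)
  define v where "v x = (\<Sum>\<^sub>\<infinity>n. V n x)" for x
  define s where "s k x = (\<Sum>\<^sub>\<infinity>n. \<sigma> n k x)" for k x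
  have "series_on r S v (4/3)"
    by (rule series_on_infsum[OF _ geo r]) (use V(1) Vs in \<open>auto simp: v_def\<close>)
  moreover have "series_on r (S - {t}) (s k) (4/3 * (C / r $ t ^ k))" if "k < p" for k
    by (rule series_on_infsum[OF _ geoC r]) (use \<sigma> \<sigma>s that in \<open>auto simp: s_def\<close>)
  moreover have "v x \<noteq> 0 \<and> v x * (x $ t ^ p + g x) = x $ t ^ p + (\<Sum>k<p. s k x * x $ t ^ k)"
    if x: "x \<in> polydisc r" for x
  proof -
    have V0: "V 0 x = 1" using V(1)[of 0] by simp
    have sv: "(\<lambda>n. V n x) sums v x" using has_sum_imp_sums[OF Vs[OF x]] by (simp add: v_def)
    then have svS: "(\<lambda>n. V (Suc n) x) sums (v x - 1)" using V0 sums_Suc_iff[of "\<lambda>n. V n x" "v x - 1"] by simp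
    have ss: "(\<lambda>n. \<sigma> n k x) sums s k x" if "k < p" for k
      using has_sum_imp_sums[OF \<sigma>s[OF x that]] by (simp add: s_def)
    have "(\<lambda>n. (1/4::real) ^ Suc n) sums (4/3 - 1)"
      using has_sum_imp_sums[OF geo] by (subst sums_Suc_iff) simp
    then have "(\<lambda>n. (1/4::real) ^ Suc n) sums (1/3)" by simp
    then have g3: "summable (\<lambda>n. (1/4::real) ^ Suc n)" "suminf (\<lambda>n. (1/4::real) ^ Suc n) = 1/3"
      by (auto simp only: sums_iff)
    have "norm (suminf (\<lambda>n. V (Suc n) x)) \<le> suminf (\<lambda>n. (1/4) ^ Suc n)"
      by (rule norm_suminf_le[OF _ g3(1)]) (simp only: real_norm_def, rule series_on_abs_le[OF conjunct1[OF V(1)] x])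
    then have "\<bar>v x - 1\<bar> \<le> 1/3" using svS g3(2) by (simp add: sums_iff)
    then have "v x \<noteq> 0" by auto
    have "(\<lambda>n. V n x * g x + x $ t ^ p * V (Suc n) x) sums (v x * g x + x $ t ^ p * (v x - 1))"
      by (intro sums_add sums_mult sums_mult2 sv svS)
    moreover have "V n x * g x + x $ t ^ p * V (Suc n) x = (\<Sum>k<p. \<sigma> n k x * x $ t ^ k)" for n
      using Q[of n] x by (simp add: Q_def)
    moreover have "(\<lambda>n. \<Sum>k<p. \<sigma> n k x * x $ t ^ k) sums (\<Sum>k<p. s k x * x $ t ^ k)"
      by (intro sums_sum sums_mult2 ss) auto
    ultimately have "v x * g x + x $ t ^ p * (v x - 1) = (\<Sum>k<p. s k x * x $ t ^ k)"
      using sums_unique2 by auto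
    then show ?thesis using \<open>v x \<noteq> 0\<close> by (simp add: algebra_simps)
  qed
  ultimately show ?thesis by blast
qed

text \<open>
  If \<open>F\<close> does not vanish on the \<open>t\<close>-axis, let \<open>p\<close> be the order of its restriction to that axis. After
  division by the coefficient of \<open>x $ t ^ p\<close>, the other terms either contain a variable different from \<open>t\<close>
  or are of the form \<open>x $ t ^ k\<close> with \<open>k > p\<close>; they become small relative to the weight of \<open>x $ t ^ p\<close>
  when the radius \<open>\<rho>\<close> in direction \<open>t\<close> is small and the other radii are much smaller still.
\<close>
lemma weierstrass_preparation:
  assumes F: "series_on R S F B" and z: "axis t z \<in> polydisc R" "F (axis t z) \<noteq> 0"
  shows "\<exists>r p v s. (\<forall>i. 0 < r $ i) \<and> (\<exists>B'. series_on r S v B') \<and>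
    (\<forall>k<p. \<exists>B'. series_on r (S - {t}) (s k) B') \<and>
    (\<forall>x\<in>polydisc r. v x \<noteq> 0 \<and> v x * F x = x $ t ^ p + (\<Sum>k<p. s k x * x $ t ^ k))"
proof -
  note R = series_on_pos[OF F]
  obtain c M where c: "\<And>\<alpha>. c \<alpha> \<noteq> 0 \<Longrightarrow> Poly_Mapping.keys \<alpha> \<subseteq> S"
    "((\<lambda>\<alpha>. \<bar>c \<alpha>\<bar> * monomial_at \<alpha> R) has_sum M) UNIV"
    "\<And>x. x\<in>polydisc R \<Longrightarrow> ((\<lambda>\<alpha>. c \<alpha> * monomial_at \<alpha> x) has_sum F x) UNIV"
    using F unfolding series_on_def by blast
  let ?t = "\<lambda>k. Poly_Mapping.single t (k::nat)"
  have R0: "0 \<le> \<bar>c \<alpha>\<bar> * monomial_at \<alpha> R" for \<alpha>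
    using R by (intro mult_nonneg_nonneg monomial_at_nonneg less_imp_le abs_ge_zero)
  have single: "\<alpha> = ?t (Poly_Mapping.lookup \<alpha> t)" if "\<And>i. i \<noteq> t \<Longrightarrow> Poly_Mapping.lookup \<alpha> i = 0" for \<alpha> :: "'a \<Rightarrow>\<^sub>0 nat"
    by (rule poly_mapping_eqI) (use that in \<open>auto simp: lookup_single when_def\<close>)
  have ex: "\<exists>k. c (?t k) \<noteq> 0"
  proof (rule ccontr)
    assume none: "\<not> ?thesis"
    have zero: "c \<alpha> * monomial_at \<alpha> (axis t z) = 0" for \<alpha>
    proof (cases "\<forall>i. i \<noteq> t \<longrightarrow> Poly_Mapping.lookup \<alpha> i = 0")
      case True
      then show ?thesis using single[of \<alpha>] none by (metis mult_zero_left)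
    next
      case False
      then obtain i where i: "i \<noteq> t" "Poly_Mapping.lookup \<alpha> i \<noteq> 0" by blast
      have "monomial_at \<alpha> (axis t z) = 0"
        unfolding monomial_at_def by (rule prod_zero) (use i in \<open>auto simp: axis_def\<close>)
      then show ?thesis by simp
    qed
    then have "((\<lambda>\<alpha> :: 'a \<Rightarrow>\<^sub>0 nat. 0) has_sum F (axis t z)) UNIV" using c(3)[OF z(1)] by (simp only: zero)
    then show False using z(2) has_sum_unique[OF has_sum_0[OF refl]] by metis
  qed
  define p where "p = (LEAST k. c (?t k) \<noteq> 0)"
  have cp: "c (?t p) \<noteq> 0" unfolding p_def using ex by (rule LeastI_ex)
  have cless: "c (?t k) = 0" if "k < p" for k using not_less_Least that unfolding p_def by blast
  have "\<bar>c (?t p)\<bar> * monomial_at (?t p) R \<le> M"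
    using has_sum_mono'[OF has_sum_finiteI[OF _ refl, of "{?t p}"] c(2)] R0 by simp
  then have M: "0 < M" using cp R[of t] 
    by (smt (verit) mult_pos_pos monomial_at_single zero_less_abs_iff zero_less_power)
  define \<rho> where "\<rho> = min (R $ t) (\<bar>c (?t p)\<bar> * R $ t ^ Suc p / (4 * M))"
  have \<rho>: "0 < \<rho>" "\<rho> \<le> R $ t" "\<rho> \<le> \<bar>c (?t p)\<bar> * R $ t ^ Suc p / (4 * M)"
    using R[of t] cp M by (auto simp: \<rho>_def)
  \<comment> \<open>Both kinds of remaining terms shrink at least by this factor when the radius changes from R to r.\<close>
  define \<kappa> where "\<kappa> = (\<rho> / R $ t) ^ Suc p"
  have q: "0 < \<rho> / R $ t" "\<rho> / R $ t \<le> 1" using \<rho> R[of t] by auto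
  have \<kappa>: "0 < \<kappa>" "\<kappa> \<le> 1" unfolding \<kappa>_def using q by (auto intro!: power_le_one zero_less_power simp del: power_Suc)
  define r where "r = (\<chi> i. if i = t then \<rho> else R $ i * \<kappa>)"
  have r: "0 < r $ i" "r $ i \<le> R $ i" for i
    using \<rho> \<kappa> R[of i] by (auto simp: r_def mult_left_le)
  have sub: "polydisc r \<subseteq> polydisc R" by (rule polydisc_mono) (rule r)
  have small: "monomial_at \<alpha> r \<le> \<kappa> * monomial_at \<alpha> R" if \<alpha>: "\<alpha> \<noteq> ?t p" "c \<alpha> \<noteq> 0" for \<alpha>
  proof (cases "\<forall>i. i \<noteq> t \<longrightarrow> Poly_Mapping.lookup \<alpha> i = 0")
    case True
    define k where "k = Poly_Mapping.lookup \<alpha> t"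
    have k: "\<alpha> = ?t k" unfolding k_def using True by (intro single) auto
    then have "Suc p \<le> k" using \<alpha> cless[of k] by (metis Suc_leI linorder_neqE_nat)
    then have "(\<rho> / R $ t) ^ k \<le> \<kappa>" unfolding \<kappa>_def using q by (intro power_decreasing) auto
    then have "(\<rho> / R $ t) ^ k * R $ t ^ k \<le> \<kappa> * R $ t ^ k" using R[of t] by (intro mult_right_mono) auto
    then show ?thesis using R[of t] by (simp add: k monomial_at_single r_def power_divide)
  next
    case False
    then obtain i where i: "i \<noteq> t" "Poly_Mapping.lookup \<alpha> i \<noteq> 0" by blast
    let ?l = "Poly_Mapping.lookup \<alpha>"
    have "\<kappa> ^ ?l i \<le> \<kappa> ^ 1" using i \<kappa> by (intro power_decreasing) auto
    then have "R $ i ^ ?l i * \<kappa> ^ ?l i \<le> R $ i ^ ?l i * \<kappa>"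
      using R[of i] by (intro mult_left_mono) auto
    then have *: "r $ i ^ ?l i \<le> \<kappa> * R $ i ^ ?l i"
      using i by (simp add: r_def power_mult_distrib mult.commute)
    have "(\<Prod>j\<in>UNIV - {i}. r $ j ^ ?l j) \<le> (\<Prod>j\<in>UNIV - {i}. R $ j ^ ?l j)"
      using r by (intro prod_mono conjI power_mono zero_le_power) (auto intro: less_imp_le)
    then have "r $ i ^ ?l i * (\<Prod>j\<in>UNIV - {i}. r $ j ^ ?l j) \<le> (\<kappa> * R $ i ^ ?l i) * (\<Prod>j\<in>UNIV - {i}. R $ j ^ ?l j)"
      by (intro mult_mono * mult_nonneg_nonneg prod_nonneg ballI zero_le_power less_imp_le[OF r(1)]
          less_imp_le[OF R] less_imp_le[OF \<kappa>(1)])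
    then show ?thesis unfolding monomial_at_def
      by (simp add: prod.remove[of UNIV i] mult.assoc)
  qed
  define g where "g x = F x / c (?t p) - x $ t ^ p" for x
  let ?J = "UNIV - {?t p}" and ?a = "\<lambda>\<alpha>. c \<alpha> / c (?t p)"
  let ?K = "\<kappa> * M / \<bar>c (?t p)\<bar>"
  have bnd: "\<bar>?a \<alpha>\<bar> * monomial_at \<alpha> r \<le> (\<bar>c \<alpha>\<bar> * monomial_at \<alpha> R) * (\<kappa> / \<bar>c (?t p)\<bar>)" if "\<alpha> \<in> ?J" for \<alpha>
  proof (cases "c \<alpha> = 0")
    case False
    then have "\<bar>?a \<alpha>\<bar> * monomial_at \<alpha> r \<le> \<bar>?a \<alpha>\<bar> * (\<kappa> * monomial_at \<alpha> R)"
      using small that by (intro mult_left_mono) auto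
    then show ?thesis by (simp add: mult_ac)
  qed simp
  have sumR: "((\<lambda>\<alpha>. (\<bar>c \<alpha>\<bar> * monomial_at \<alpha> R) * (\<kappa> / \<bar>c (?t p)\<bar>)) has_sum M * (\<kappa> / \<bar>c (?t p)\<bar>)) UNIV"
    by (rule has_sum_cmult_left[OF c(2)])
  have sumr: "(\<lambda>\<alpha>. \<bar>?a \<alpha>\<bar> * monomial_at \<alpha> r) summable_on ?J"
    by (rule summable_on_comparison_test[OF summable_on_subset[OF has_sum_imp_summable[OF sumR]] bnd])
      (auto intro!: mult_nonneg_nonneg monomial_at_nonneg less_imp_le[OF r(1)])
  have nonneg: "0 \<le> (\<bar>c \<alpha>\<bar> * monomial_at \<alpha> R) * (\<kappa> / \<bar>c (?t p)\<bar>)" for \<alpha>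
    using \<kappa>(1) by (intro mult_nonneg_nonneg[OF R0]) simp
  have le: "infsum (\<lambda>\<alpha>. \<bar>?a \<alpha>\<bar> * monomial_at \<alpha> r) ?J \<le> M * (\<kappa> / \<bar>c (?t p)\<bar>)"
    by (rule has_sum_mono_neutral[OF has_sum_infsum[OF sumr] sumR])
      (use bnd in blast, blast, rule nonneg)
  have g: "series_on r S g (M * (\<kappa> / \<bar>c (?t p)\<bar>))"
  proof (rule series_on_family[OF r(1) _ has_sum_infsum[OF sumr] le])
    show "Poly_Mapping.keys \<alpha> \<subseteq> S" if "?a \<alpha> \<noteq> 0" for \<alpha> using c(1) that by auto
    fix x assume x: "x \<in> polydisc r"
    have "((\<lambda>\<alpha>. c \<alpha> * monomial_at \<alpha> x * (1 / c (?t p))) has_sum F x * (1 / c (?t p))) UNIV"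
      using c(3) x sub by (intro has_sum_cmult_left) auto
    then have "((\<lambda>\<alpha>. ?a \<alpha> * monomial_at \<alpha> x) has_sum F x / c (?t p)) UNIV" by simp
    moreover have "((\<lambda>\<alpha>. ?a \<alpha> * monomial_at \<alpha> x) has_sum x $ t ^ p) {?t p}"
      using cp by (intro has_sum_finiteI) (auto simp: monomial_at_single)
    ultimately show "((\<lambda>\<alpha>. ?a \<alpha> * monomial_at \<alpha> x) has_sum g x) ?J"
      unfolding g_def by (rule has_sum_Diff) auto
  qed
  have "M * (\<kappa> / \<bar>c (?t p)\<bar>) = \<rho> ^ p * (\<rho> * M / (\<bar>c (?t p)\<bar> * R $ t ^ Suc p))"
    by (simp add: \<kappa>_def power_divide mult_ac)
  also have "\<rho> * M / (\<bar>c (?t p)\<bar> * R $ t ^ Suc p) \<le> 1/4"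
  proof -
    have "0 < \<bar>c (?t p)\<bar> * R $ t ^ Suc p" using cp R[of t] by simp
    then show ?thesis using \<rho>(3) M by (simp add: divide_simps mult_ac)
  qed
  finally have C: "M * (\<kappa> / \<bar>c (?t p)\<bar>) \<le> r $ t ^ p / 4"
    using \<rho>(1) by (simp add: r_def mult_left_mono)
  from weierstrass_iteration[OF g C] obtain v s where
    v: "series_on r S v (4/3)" and s: "\<forall>k<p. \<exists>B. series_on r (S - {t}) (s k) B" and
    vs: "\<forall>x\<in>polydisc r. v x \<noteq> 0 \<and> v x * (x $ t ^ p + g x) = x $ t ^ p + (\<Sum>k<p. s k x * x $ t ^ k)"
    by blast
  show ?thesis
  proof (intro exI conjI)
    show "\<forall>i. 0 < r $ i" using r by blast
    show "series_on r S (\<lambda>x. (1 / c (?t p)) * v x) (\<bar>1 / c (?t p)\<bar> * (4/3))"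
      by (rule series_on_cmult[OF v])
    show "\<forall>k<p. \<exists>B'. series_on r (S - {t}) (s k) B'" by (rule s)
    show "\<forall>x\<in>polydisc r. (1 / c (?t p)) * v x \<noteq> 0 \<and>
        ((1 / c (?t p)) * v x) * F x = x $ t ^ p + (\<Sum>k<p. s k x * x $ t ^ k)"
      using vs cp by (auto simp: g_def)
  qed
qed

section \<open>Linear shears\<close>

text \<open>
  The change of variables that tilts the \<open>t\<close>-axis into the direction with \<open>t\<close>-component \<open>1 + w t\<close> and other components \<open>w i\<close>, so that
  a function that is not identically zero becomes nonzero on that axis.
\<close>
definition shear :: "'n \<Rightarrow> ('n \<Rightarrow> real) \<Rightarrow> real ^ 'n \<Rightarrow> real ^ 'n"
  where "shear t w x = (\<chi> i. x $ i + w i * x $ t)"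

lemma series_on_shear:
  assumes F: "series_on (\<chi> i. \<rho>) S F B" and t: "t \<in> S" and w: "\<And>i. \<bar>w i\<bar> \<le> 1"
  shows "series_on (\<chi> i. \<rho> / 2) S (\<lambda>x. F (shear t w x)) B"
proof -
  let ?R = "\<chi> i. \<rho> :: real ^ 'a" and ?r = "\<chi> i. \<rho> / 2 :: real ^ 'a"
  obtain c M where c: "\<And>\<alpha>. c \<alpha> \<noteq> 0 \<Longrightarrow> Poly_Mapping.keys \<alpha> \<subseteq> S"
    "((\<lambda>\<alpha>. \<bar>c \<alpha>\<bar> * monomial_at \<alpha> ?R) has_sum M) UNIV" "M \<le> B"
    "\<And>x. x\<in>polydisc ?R \<Longrightarrow> ((\<lambda>\<alpha>. c \<alpha> * monomial_at \<alpha> x) has_sum F x) UNIV"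
    using F unfolding series_on_def by blast
  have \<rho>: "0 < \<rho>" using series_on_pos[OF F] by simp
  have r: "0 < ?r $ i" for i using \<rho> by simp
  have le: "\<bar>w i\<bar> * a \<le> a" if "0 \<le> a" for i a using mult_right_mono[OF w that] by simp
  have sub: "shear t w x \<in> polydisc ?R" if "x \<in> polydisc ?r" for x
  proof -
    have "\<bar>x $ i + w i * x $ t\<bar> \<le> \<rho>" for i
    proof -
      have "\<bar>x $ i\<bar> \<le> \<rho> / 2" "\<bar>x $ t\<bar> \<le> \<rho> / 2" using that by (auto simp: polydisc_def)
      moreover have "\<bar>w i * x $ t\<bar> \<le> \<bar>x $ t\<bar>" using le[of "\<bar>x $ t\<bar>" i] by (simp add: abs_mult)
      ultimately show ?thesis by linarith
    qed
    then show ?thesis by (simp add: polydisc_def shear_def)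
  qed
  have mon: "series_on ?r S (\<lambda>x. monomial_at \<alpha> (shear t w x)) (monomial_at \<alpha> ?R)"
    if "Poly_Mapping.keys \<alpha> \<subseteq> S" for \<alpha>
    unfolding monomial_at_def
  proof (rule series_on_prod[OF finite _ r])
    fix i
    show "series_on ?r S (\<lambda>x. shear t w x $ i ^ Poly_Mapping.lookup \<alpha> i) (?R $ i ^ Poly_Mapping.lookup \<alpha> i)"
    proof (cases "i \<in> S")
      case True
      have "series_on ?r S (\<lambda>x. x $ i + w i * x $ t) (?r $ i + \<bar>w i\<bar> * ?r $ t)"
        using r True t by (intro series_on_add series_on_cmult series_on_coord)
      then have "series_on ?r S (\<lambda>x. x $ i + w i * x $ t) (?R $ i)"
      proof (rule series_on_mono)
        show "?r $ i + \<bar>w i\<bar> * ?r $ t \<le> ?R $ i"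
          unfolding vec_lambda_beta using le[of "\<rho> / 2" i] \<rho> by linarith
      qed (use r in auto)
      then show ?thesis unfolding shear_def vec_lambda_beta by (rule series_on_power)
    next
      case False
      then have "Poly_Mapping.lookup \<alpha> i = 0" using that by (auto simp: in_keys_iff)
      then show ?thesis using series_on_const[of ?r S 1] \<rho> by simp
    qed
  qed
  have "series_on ?r S (\<lambda>x. F (shear t w x)) M"
  proof (rule series_on_infsum[OF _ c(2) r])
    show "series_on ?r S (\<lambda>x. c \<alpha> * monomial_at \<alpha> (shear t w x)) (\<bar>c \<alpha>\<bar> * monomial_at \<alpha> ?R)" for \<alpha>
    proof (cases "c \<alpha> = 0")
      case True
      then show ?thesis using series_on_const[of ?r S 0] \<rho> by simp
    next
      case False
      then show ?thesis using mon[OF c(1)] by (intro series_on_cmult) auto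
    qed
  qed (use c(4) sub in auto)
  then show ?thesis by (rule series_on_mono) (use r c(3) in auto)
qed

lemma norm_shear_le:
  fixes x :: "real ^ 'n::finite"
  assumes "\<And>i. \<bar>w i\<bar> \<le> 1"
  shows "norm (shear t w x) \<le> (2 * real CARD('n)) * norm x"
proof -
  have "norm (shear t w x) \<le> (\<Sum>i\<in>UNIV. \<bar>shear t w x $ i\<bar>)" by (rule norm_le_l1_cart)
  also have "\<dots> \<le> (\<Sum>i\<in>(UNIV::'n set). 2 * norm x)"
  proof (rule sum_mono)
    fix i
    have "\<bar>w i * x $ t\<bar> \<le> 1 * \<bar>x $ t\<bar>" unfolding abs_mult using assms by (rule mult_right_mono) simp
    then show "\<bar>shear t w x $ i\<bar> \<le> 2 * norm x"
      using component_le_norm_cart[of x i] component_le_norm_cart[of x t] by (simp add: shear_def)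
  qed
  finally show ?thesis by simp
qed

lemma shear_diff: "shear t w (x - y) = shear t w x - shear t w y"
  by (simp add: shear_def vec_eq_iff algebra_simps)

lemma shear_inverse: "w t = 0 \<Longrightarrow> shear t w (shear t (\<lambda>i. - w i) x) = x"
  by (simp add: shear_def vec_eq_iff)

section \<open>Germs of analytic functions\<close>

text \<open>
  Any radius can be replaced by the smallest of its components, so a constant radius is no restriction.
\<close>
definition germ :: "'n set \<Rightarrow> (real ^ 'n::finite \<Rightarrow> real) \<Rightarrow> bool"
  where "germ S F \<longleftrightarrow> (\<exists>\<rho> B. series_on (\<chi> i. \<rho>) S F B)"

lemma germI:
  assumes "series_on r S F B"
  shows "germ S F"
proof -
  let ?m = "Min (range (\<lambda>i. r $ i))"
  have "0 < ?m" using series_on_pos[OF assms] by simp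
  then have "series_on (\<chi> i. ?m) S F B"
    by (intro series_on_mono[OF assms]) auto
  then show ?thesis unfolding germ_def by blast
qed

lemma germ_common_radius:
  assumes "germ S F" "germ S G"
  obtains \<rho> A B where "series_on (\<chi> i. \<rho>) S F A" "series_on (\<chi> i. \<rho>) S G B"
proof -
  obtain \<rho>1 A \<rho>2 B where F: "series_on (\<chi> i. \<rho>1) S F A" and G: "series_on (\<chi> i. \<rho>2) S G B"
    using assms unfolding germ_def by blast
  have p: "0 < \<rho>1" "0 < \<rho>2" using series_on_pos[OF F] series_on_pos[OF G] by auto
  show ?thesis
    by (rule that[of "min \<rho>1 \<rho>2" A B]; rule series_on_mono[OF F] series_on_mono[OF G]) (use p in auto)
qed

lemma germ_const: "germ S (\<lambda>x. k)"
  by (rule germI[OF series_on_const[of "\<chi> i. 1"]]) simp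

lemma germ_coord: "i \<in> S \<Longrightarrow> germ S (\<lambda>x. x $ i)"
  by (rule germI[OF series_on_coord[of "\<chi> i. 1"]]) auto

lemma germ_add: "germ S F \<Longrightarrow> germ S G \<Longrightarrow> germ S (\<lambda>x. F x + G x)"
  by (erule (1) germ_common_radius) (rule germI, rule series_on_add)

lemma germ_mult: "germ S F \<Longrightarrow> germ S G \<Longrightarrow> germ S (\<lambda>x. F x * G x)"
  by (erule (1) germ_common_radius) (rule germI, rule series_on_mult)

lemma germ_diff: "germ S F \<Longrightarrow> germ S G \<Longrightarrow> germ S (\<lambda>x. F x - G x)"
  using germ_add[of S F "\<lambda>x. (-1) * G x"] germ_mult[OF germ_const, of S G "-1"] by simp

lemma germ_power: "germ S F \<Longrightarrow> germ S (\<lambda>x. F x ^ n)"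
  by (induction n) (auto intro: germ_mult germ_const)

lemma germ_sum: "finite I \<Longrightarrow> (\<And>i. i \<in> I \<Longrightarrow> germ S (F i)) \<Longrightarrow> germ S (\<lambda>x. \<Sum>i\<in>I. F i x)"
  by (induction I rule: finite_induct) (auto intro: germ_add germ_const)

lemma germ_mono:
  assumes "germ S F" "S \<subseteq> T"
  shows "germ T F"
proof -
  obtain \<rho> B where F: "series_on (\<chi> i. \<rho>) S F B" using assms(1) unfolding germ_def by blast
  show ?thesis
    by (rule germI, rule series_on_mono[OF F series_on_pos[OF F] order_refl assms(2) order_refl]) simp
qed

lemma polydisc_const_if_small: "norm x < \<rho> \<Longrightarrow> x \<in> polydisc (\<chi> i. \<rho>)"
  unfolding polydisc_def using component_le_norm_cart[of x] by (auto intro: order_trans less_imp_le)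

lemma germ_depends:
  assumes "germ S F"
  shows "\<exists>\<delta>>0. \<forall>x y. norm x < \<delta> \<longrightarrow> norm y < \<delta> \<longrightarrow> (\<forall>i\<in>S. x $ i = y $ i) \<longrightarrow> F x = F y"
proof -
  obtain \<rho> B where F: "series_on (\<chi> i. \<rho>) S F B" using assms unfolding germ_def by blast
  then have "0 < \<rho>" using series_on_pos[OF F] by simp
  then show ?thesis using series_on_depends[OF F] polydisc_const_if_small by blast
qed

lemma germ_bounded:
  assumes "germ S F"
  shows "\<exists>\<delta>>0. \<exists>B\<ge>0. \<forall>x. norm x < \<delta> \<longrightarrow> \<bar>F x\<bar> \<le> B"
proof -
  obtain \<rho> B where F: "series_on (\<chi> i. \<rho>) S F B" using assms unfolding germ_def by blast
  then have "0 < \<rho>" using series_on_pos[OF F] by simp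
  then show ?thesis using series_on_abs_le[OF F] series_on_nonneg[OF F] polydisc_const_if_small by blast
qed

lemma germ_lipschitz:
  assumes "germ S F"
  shows "\<exists>\<delta>>0. \<exists>L\<ge>0. \<forall>x y. norm x < \<delta> \<longrightarrow> norm y < \<delta> \<longrightarrow> \<bar>F x - F y\<bar> \<le> L * norm (x - y)"
proof -
  obtain \<rho> B where F: "series_on (\<chi> i. \<rho>) S F B" using assms unfolding germ_def by blast
  have "0 < \<rho>" using series_on_pos[OF F] by simp
  have half: "(1/2) *\<^sub>R (\<chi> i. \<rho>) = (\<chi> i. \<rho> / 2 :: real ^ 'a)" by (simp add: vec_eq_iff)
  obtain L where L: "0 \<le> L" "\<forall>x\<in>polydisc (\<chi> i. \<rho> / 2). \<forall>y\<in>polydisc (\<chi> i. \<rho> / 2). \<bar>F x - F y\<bar> \<le> L * norm (x - y)"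
    using series_on_lipschitz[OF F] unfolding half by blast
  have "\<forall>x y. norm x < \<rho> / 2 \<longrightarrow> norm y < \<rho> / 2 \<longrightarrow> \<bar>F x - F y\<bar> \<le> L * norm (x - y)"
    using L(2) polydisc_const_if_small by blast
  then show ?thesis using L(1) half_gt_zero[OF \<open>0 < \<rho>\<close>] by blast
qed

lemma germ_common_radius_upto:
  assumes "\<And>k. k \<le> n \<Longrightarrow> germ S (a k)"
  shows "\<exists>\<rho> B. \<forall>k\<le>(n::nat). series_on (\<chi> i. \<rho>) S (a k) B"
  using assms
proof (induction n)
  case 0
  then show ?case unfolding germ_def by auto
next
  case (Suc n)
  then obtain \<rho> B where 1: "\<forall>k\<le>n. series_on (\<chi> i. \<rho>) S (a k) B" by fastforce
  obtain \<rho>' B' where 2: "series_on (\<chi> i. \<rho>') S (a (Suc n)) B'"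
    using Suc.prems[of "Suc n"] unfolding germ_def by auto
  have p: "0 < \<rho>" "0 < \<rho>'" using series_on_pos[OF 1[rule_format, of 0]] series_on_pos[OF 2] by auto
  have "series_on (\<chi> i. min \<rho> \<rho>') S (a k) (max B B')" if "k \<le> Suc n" for k
  proof (cases "k = Suc n")
    case True
    show ?thesis unfolding True by (rule series_on_mono[OF 2]) (use p in auto)
  next
    case False
    with that have "k \<le> n" by simp
    then have *: "series_on (\<chi> i. \<rho>) S (a k) B" using 1 by blast
    show ?thesis by (rule series_on_mono[OF *]) (use p in auto)
  qed
  then show ?case by blast
qed

definition poly_in :: "'n \<Rightarrow> (nat \<Rightarrow> real ^ 'n \<Rightarrow> real) \<Rightarrow> nat \<Rightarrow> real ^ 'n::finite \<Rightarrow> real"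
  where "poly_in t a n x = (\<Sum>k\<le>n. a k x * x $ t ^ k)"

lemma germ_poly_in:
  assumes "\<And>k. k \<le> n \<Longrightarrow> germ (S - {t}) (a k)" "t \<in> S"
  shows "germ S (poly_in t a n)"
  unfolding poly_in_def
  by (intro germ_sum germ_mult germ_power germ_coord)
    (use assms germ_mono[of "S - {t}" _ S] in auto)

lemma poly_in_Suc: "poly_in t a (Suc n) x = poly_in t a n x + a (Suc n) x * x $ t ^ Suc n"
  by (simp add: poly_in_def)

lemma poly_in_shift:
  "poly_in t (\<lambda>k. if m \<le> k then a (k - m) else (\<lambda>_. 0)) (m + q) x = x $ t ^ m * poly_in t a q x"
proof (induction m)
  case (Suc m)
  have "poly_in t (\<lambda>k. if Suc m \<le> k then a (k - Suc m) else (\<lambda>_. 0)) (Suc m + q) x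
      = x $ t * poly_in t (\<lambda>k. if m \<le> k then a (k - m) else (\<lambda>_. 0)) (m + q) x"
    unfolding poly_in_def add_Suc sum.atMost_Suc_shift
    by (simp add: sum_distrib_left mult_ac cong: if_cong)
  then show ?case using Suc by (simp add: mult_ac)
qed (simp add: poly_in_def)

section \<open>Real roots near simple approximate roots\<close>

lemma power_taylor_bound:
  fixes u \<tau> :: real
  assumes "\<bar>u\<bar> \<le> 1" "\<bar>\<tau>\<bar> \<le> 1"
  shows "\<bar>(u + \<tau>) ^ Suc k - u ^ Suc k - real (Suc k) * u ^ k * \<tau>\<bar> \<le> 4 ^ Suc k * \<tau>\<^sup>2"
proof (induction k)
  case (Suc k)
  define E where "E = (u + \<tau>) ^ Suc k - u ^ Suc k - real (Suc k) * u ^ k * \<tau>"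
  have eq: "(u + \<tau>) ^ Suc (Suc k) - u ^ Suc (Suc k) - real (Suc (Suc k)) * u ^ Suc k * \<tau>
      = (u + \<tau>) * E + real (Suc k) * u ^ k * \<tau>\<^sup>2"
    by (simp add: E_def algebra_simps power2_eq_square)
  have "\<bar>u + \<tau>\<bar> \<le> 2" using assms by linarith
  then have 1: "\<bar>(u + \<tau>) * E\<bar> \<le> 2 * (4 ^ Suc k * \<tau>\<^sup>2)"
    unfolding abs_mult using Suc by (intro mult_mono) (auto simp: E_def)
  have "\<bar>u\<bar> ^ k \<le> 1" using assms by (intro power_le_one) auto
  then have 2: "\<bar>real (Suc k) * u ^ k * \<tau>\<^sup>2\<bar> \<le> real (Suc k) * \<tau>\<^sup>2"
    unfolding abs_mult power_abs by (intro mult_mono) (auto simp: mult_left_le)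
  have "Suc k < 2 ^ Suc k" by (rule less_exp)
  also have "(2::nat) ^ Suc k \<le> 4 ^ Suc k" by (rule power_mono) auto
  finally have "real (Suc k) \<le> 4 ^ Suc k"
    by (metis less_imp_le of_nat_le_iff of_nat_numeral of_nat_power)
  then have "real (Suc k) * \<tau>\<^sup>2 \<le> 4 ^ Suc k * \<tau>\<^sup>2" by (rule mult_right_mono) simp
  moreover have "4 ^ Suc (Suc k) * \<tau>\<^sup>2 = 4 * (4 ^ Suc k * \<tau>\<^sup>2)" "0 \<le> 4 ^ Suc k * \<tau>\<^sup>2" by simp_all
  ultimately show ?case unfolding eq using 1 2 by linarith
qed simp

lemma polynomial_taylor_bound:
  fixes A :: "nat \<Rightarrow> real"
  assumes A: "\<And>k. k \<le> Suc q \<Longrightarrow> \<bar>A k\<bar> \<le> B" and "\<bar>u\<bar> \<le> 1" "\<bar>\<tau>\<bar> \<le> 1"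
  shows "\<bar>(\<Sum>k\<le>Suc q. A k * (u + \<tau>) ^ k) - (\<Sum>k\<le>Suc q. A k * u ^ k)
      - (\<Sum>k\<le>q. real (Suc k) * A (Suc k) * u ^ k) * \<tau>\<bar> \<le> (\<Sum>k\<le>q. B * 4 ^ Suc k) * \<tau>\<^sup>2"
proof -
  have "(\<Sum>k\<le>Suc q. A k * (u + \<tau>) ^ k) - (\<Sum>k\<le>Suc q. A k * u ^ k)
      - (\<Sum>k\<le>q. real (Suc k) * A (Suc k) * u ^ k) * \<tau>
    = (\<Sum>k\<le>q. A (Suc k) * ((u + \<tau>) ^ Suc k - u ^ Suc k - real (Suc k) * u ^ k * \<tau>))"
  proof -
    have "(\<Sum>k\<le>q. A (Suc k) * ((u + \<tau>) ^ Suc k - u ^ Suc k - real (Suc k) * u ^ k * \<tau>))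
      = (\<Sum>k\<le>q. A (Suc k) * (u + \<tau>) ^ Suc k) - (\<Sum>k\<le>q. A (Suc k) * u ^ Suc k)
        - (\<Sum>k\<le>q. A (Suc k) * (real (Suc k) * u ^ k * \<tau>))"
      by (simp only: right_diff_distrib sum_subtractf)
    also have "(\<Sum>k\<le>q. A (Suc k) * (real (Suc k) * u ^ k * \<tau>)) = (\<Sum>k\<le>q. real (Suc k) * A (Suc k) * u ^ k) * \<tau>"
      unfolding sum_distrib_right by (intro sum.cong refl) (simp only: mult_ac)
    finally show ?thesis
      unfolding sum.atMost_Suc_shift by simp
  qed
  also have "\<bar>\<dots>\<bar> \<le> (\<Sum>k\<le>q. B * (4 ^ Suc k * \<tau>\<^sup>2))"
  proof (rule order_trans[OF sum_abs], rule sum_mono)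
    fix k assume "k \<in> {..q}"
    then show "\<bar>A (Suc k) * ((u + \<tau>) ^ Suc k - u ^ Suc k - real (Suc k) * u ^ k * \<tau>)\<bar> \<le> B * (4 ^ Suc k * \<tau>\<^sup>2)"
      unfolding abs_mult using A[of "Suc k"] assms(2,3)
      by (intro mult_mono power_taylor_bound) (auto intro: order_trans[OF abs_ge_zero])
  qed
  also have "\<dots> = (\<Sum>k\<le>q. B * 4 ^ Suc k) * \<tau>\<^sup>2"
    by (simp add: sum_distrib_right mult.assoc)
  finally show ?thesis .
qed

text \<open>
  The linear term dominates at \<open>\<eta>\<close> and \<open>- \<eta>\<close>, so \<open>\<phi>\<close> changes sign between them.
\<close>
lemma root_near_simple_approximate_root:
  fixes \<phi> :: "real \<Rightarrow> real"
  assumes cont: "continuous_on {-\<eta>..\<eta>} \<phi>" and \<eta>: "0 < \<eta>"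
    and taylor: "\<And>\<tau>. \<bar>\<tau>\<bar> \<le> \<eta> \<Longrightarrow> \<bar>\<phi> \<tau> - \<phi> 0 - D * \<tau>\<bar> \<le> C * \<tau>\<^sup>2"
    and small: "\<bar>\<phi> 0\<bar> + C * \<eta>\<^sup>2 \<le> \<bar>D\<bar> * \<eta>"
  shows "\<exists>\<tau>. \<bar>\<tau>\<bar> \<le> \<eta> \<and> \<phi> \<tau> = 0"
proof -
  have p: "\<bar>\<phi> \<eta> - \<phi> 0 - D * \<eta>\<bar> \<le> C * \<eta>\<^sup>2" and m: "\<bar>\<phi> (-\<eta>) - \<phi> 0 + D * \<eta>\<bar> \<le> C * \<eta>\<^sup>2"
    using taylor[of \<eta>] taylor[of "-\<eta>"] \<eta> by auto
  show ?thesis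
  proof (cases "0 \<le> D")
    case True
    then have "\<phi> (-\<eta>) \<le> 0" "0 \<le> \<phi> \<eta>" using p m small by linarith+
    then obtain \<tau> where "-\<eta> \<le> \<tau>" "\<tau> \<le> \<eta>" "\<phi> \<tau> = 0" using IVT'[of \<phi> "-\<eta>" 0 \<eta>] cont \<eta> by auto
    then show ?thesis by (intro exI[of _ \<tau>]) auto
  next
    case False
    then have "\<bar>D\<bar> * \<eta> = - (D * \<eta>)" by simp
    then have "0 \<le> \<phi> (-\<eta>)" "\<phi> \<eta> \<le> 0" using p m small by linarith+
    then obtain \<tau> where "-\<eta> \<le> \<tau>" "\<tau> \<le> \<eta>" "\<phi> \<tau> = 0" using IVT2'[of \<phi> \<eta> 0 "-\<eta>"] cont \<eta> by auto
    then show ?thesis by (intro exI[of _ \<tau>]) auto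
  qed
qed

section \<open>Flat and visible functions\<close>

lemma frequently_filter_mono: "frequently P V \<Longrightarrow> V \<le> U \<Longrightarrow> frequently P U"
  unfolding frequently_def by (blast dest: filter_leD)

text \<open>
  A fixed scale against which orders of vanishing are measured. The filters \<open>U\<close> used later are finer
  than \<open>U\<^sub>0\<close>; refining the filter replaces passing to a subsequence.
\<close>
locale infinitesimal =
  fixes \<epsilon> :: "'k \<Rightarrow> real" and U\<^sub>0 :: "'k filter"
  assumes pos: "0 < \<epsilon> k" and lt1: "\<epsilon> k < 1" and lim: "(\<epsilon> \<longlongrightarrow> 0) U\<^sub>0"
begin

definition flat :: "'k filter \<Rightarrow> ('k \<Rightarrow> real) \<Rightarrow> bool"
  where "flat U a \<longleftrightarrow> (\<forall>N. \<forall>\<^sub>F k in U. \<bar>a k\<bar> \<le> \<epsilon> k ^ N)"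

definition visible :: "'k filter \<Rightarrow> ('k \<Rightarrow> real) \<Rightarrow> bool"
  where "visible U a \<longleftrightarrow> (\<exists>N. \<forall>\<^sub>F k in U. \<epsilon> k ^ N \<le> \<bar>a k\<bar>)"

lemma flat_mono: "flat U a \<Longrightarrow> V \<le> U \<Longrightarrow> flat V a"
  unfolding flat_def by (blast intro: filter_leD)

lemma visible_mono: "visible U a \<Longrightarrow> V \<le> U \<Longrightarrow> visible V a"
  unfolding visible_def by (blast intro: filter_leD)

lemma eventually_const_mult_le:
  assumes "U \<le> U\<^sub>0" "0 < c"
  shows "\<forall>\<^sub>F k in U. C * \<epsilon> k ^ Suc N \<le> c * \<epsilon> k ^ N"
proof -
  have "((\<lambda>k. C * \<epsilon> k) \<longlongrightarrow> C * 0) U" by (intro tendsto_mult_left tendsto_mono[OF assms(1) lim])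
  then have "\<forall>\<^sub>F k in U. C * \<epsilon> k < c" by (rule order_tendstoD) (use assms(2) in simp)
  then show ?thesis
  proof eventually_elim
    case (elim k)
    have "(C * \<epsilon> k) * \<epsilon> k ^ N \<le> c * \<epsilon> k ^ N"
      using elim pos[of k] by (intro mult_right_mono) auto
    then show ?case by (simp add: mult.assoc)
  qed
qed

lemma flat_cong: "\<forall>\<^sub>F k in U. a k = b k \<Longrightarrow> flat U a \<Longrightarrow> flat U b"
  unfolding flat_def by (auto elim: eventually_elim2)

lemma flat_mult_bounded:
  assumes "flat U a" "U \<le> U\<^sub>0" "\<forall>\<^sub>F k in U. \<bar>b k\<bar> \<le> B"
  shows "flat U (\<lambda>k. b k * a k)"
  unfolding flat_def
proof
  fix N
  have "\<forall>\<^sub>F k in U. \<bar>a k\<bar> \<le> \<epsilon> k ^ Suc N" using assms(1) unfolding flat_def by blast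
  moreover have "\<forall>\<^sub>F k in U. B * \<epsilon> k ^ Suc N \<le> 1 * \<epsilon> k ^ N"
    by (rule eventually_const_mult_le[OF assms(2)]) simp
  ultimately show "\<forall>\<^sub>F k in U. \<bar>b k * a k\<bar> \<le> \<epsilon> k ^ N"
    using assms(3)
  proof eventually_elim
    case (elim k)
    have "\<bar>b k * a k\<bar> \<le> B * \<epsilon> k ^ Suc N"
      unfolding abs_mult using elim by (intro mult_mono) auto
    with elim show ?case by simp
  qed
qed

lemma flat_add:
  assumes "flat U a" "flat U b" "U \<le> U\<^sub>0"
  shows "flat U (\<lambda>k. a k + b k)"
  unfolding flat_def
proof
  fix N
  have "\<forall>\<^sub>F k in U. \<bar>a k\<bar> \<le> \<epsilon> k ^ Suc N" "\<forall>\<^sub>F k in U. \<bar>b k\<bar> \<le> \<epsilon> k ^ Suc N"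
    using assms(1,2) unfolding flat_def by blast+
  moreover have "\<forall>\<^sub>F k in U. 2 * \<epsilon> k ^ Suc N \<le> 1 * \<epsilon> k ^ N"
    by (rule eventually_const_mult_le[OF assms(3)]) simp
  ultimately show "\<forall>\<^sub>F k in U. \<bar>a k + b k\<bar> \<le> \<epsilon> k ^ N"
    by eventually_elim linarith
qed

lemma flat_diff:
  assumes "flat U a" "flat U b" "U \<le> U\<^sub>0"
  shows "flat U (\<lambda>k. a k - b k)"
proof -
  have "flat U (\<lambda>k. - b k)" using assms(2) by (simp add: flat_def)
  from flat_add[OF assms(1) this assms(3)] show ?thesis by simp
qed

lemma flat_not_visible:
  assumes "flat U a" "visible U a" "U \<noteq> bot"
  shows False
proof -
  obtain N where "\<forall>\<^sub>F k in U. \<epsilon> k ^ N \<le> \<bar>a k\<bar>" using assms(2) unfolding visible_def by blast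
  moreover have "\<forall>\<^sub>F k in U. \<bar>a k\<bar> \<le> \<epsilon> k ^ Suc N" using assms(1) unfolding flat_def by blast
  ultimately have "\<forall>\<^sub>F k in U. False"
  proof eventually_elim
    case (elim k)
    have "\<epsilon> k ^ Suc N < \<epsilon> k ^ N" using pos[of k] lt1[of k] by simp
    with elim show ?case by simp
  qed
  with assms(3) show False by simp
qed

text \<open>
  With respect to a fixed filter a function may be neither flat nor visible. This lemma and the next one
  decide the question in either direction by a refinement of the filter, which keeps all
  functions flat or visible that already are.
\<close>
lemma exists_visible_subfilter:
  assumes "\<not> flat U a"
  shows "\<exists>V\<le>U. V \<noteq> bot \<and> visible V a"
proof -
  obtain N where N: "\<not> (\<forall>\<^sub>F k in U. \<bar>a k\<bar> \<le> \<epsilon> k ^ N)" using assms unfolding flat_def by blast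
  let ?V = "inf U (principal {k. \<epsilon> k ^ N \<le> \<bar>a k\<bar>})"
  have "?V \<noteq> bot"
  proof
    assume "?V = bot"
    then have "\<forall>\<^sub>F k in ?V. False" by simp
    then have "\<forall>\<^sub>F k in U. \<not> \<epsilon> k ^ N \<le> \<bar>a k\<bar>" by (simp add: eventually_inf_principal)
    then have "\<forall>\<^sub>F k in U. \<bar>a k\<bar> \<le> \<epsilon> k ^ N" by eventually_elim simp
    with N show False by blast
  qed
  moreover have "visible ?V a" unfolding visible_def
    by (rule exI[of _ N]) (simp add: eventually_inf_principal)
  ultimately show ?thesis by (intro exI[of _ ?V]) auto
qed

lemma exists_flat_subfilter:
  assumes "\<not> visible U a"
  shows "\<exists>V\<le>U. V \<noteq> bot \<and> flat V a"
proof -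
  let ?P = "\<lambda>N. {k. \<bar>a k\<bar> \<le> \<epsilon> k ^ N}"
  let ?V = "INF N. inf U (principal (?P N))"
  have anti: "inf U (principal (?P N)) \<le> inf U (principal (?P M))" if "M \<le> N" for M N
  proof -
    have "\<epsilon> k ^ N \<le> \<epsilon> k ^ M" for k
      using that pos[of k] lt1[of k] by (intro power_decreasing) auto
    then have "?P N \<subseteq> ?P M" using order_trans by blast
    then show ?thesis by (intro inf_mono order_refl) simp
  qed
  have ev: "eventually P ?V \<longleftrightarrow> (\<exists>N. eventually P (inf U (principal (?P N))))" for P
  proof (subst eventually_INF_base)
    fix M N show "\<exists>L\<in>UNIV. inf U (principal (?P L)) \<le> inf (inf U (principal (?P M))) (inf U (principal (?P N)))"
      by (rule bexI[of _ "max M N"], rule inf_greatest[OF anti anti]) auto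
  qed auto
  have "?V \<noteq> bot"
  proof
    assume "?V = bot"
    then have "\<forall>\<^sub>F k in ?V. False" by simp
    then obtain N where "\<forall>\<^sub>F k in inf U (principal (?P N)). False" using ev by blast
    then have "\<forall>\<^sub>F k in U. \<not> \<bar>a k\<bar> \<le> \<epsilon> k ^ N" by (simp add: eventually_inf_principal)
    then have "\<forall>\<^sub>F k in U. \<epsilon> k ^ N \<le> \<bar>a k\<bar>" by eventually_elim simp
    with assms show False unfolding visible_def by blast
  qed
  moreover have "flat ?V a" unfolding flat_def ev
    by (rule allI, rule_tac x = N in exI) (simp add: eventually_inf_principal)
  moreover have "?V \<le> U" by (rule INF_lower2[of 0]) auto
  ultimately show ?thesis by blast
qed

lemma eventually_near:
  fixes X :: "'k \<Rightarrow> 'b::real_normed_vector"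
  assumes "(X \<longlongrightarrow> 0) U" "U \<le> U\<^sub>0" "0 < \<delta>"
  shows "\<forall>\<^sub>F k in U. \<forall>y. norm (y - X k) \<le> \<epsilon> k \<longrightarrow> norm y < \<delta>"
proof -
  have "\<forall>\<^sub>F k in U. norm (X k) < \<delta> / 2"
    using tendsto_norm[OF assms(1)] assms(3) by (intro order_tendstoD) auto
  moreover have "\<forall>\<^sub>F k in U. \<epsilon> k < \<delta> / 2"
    using tendsto_mono[OF assms(2) lim] assms(3) by (intro order_tendstoD) auto
  ultimately show ?thesis
  proof eventually_elim
    case (elim k)
    show ?case
    proof (intro allI impI)
      fix y assume "norm (y - X k) \<le> \<epsilon> k"
      with elim show "norm y < \<delta>" using norm_triangle_sub[of y "X k"] by linarith
    qed
  qed
qed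

lemma eventually_small:
  fixes X :: "'k \<Rightarrow> 'b::real_normed_vector"
  assumes "(X \<longlongrightarrow> 0) U" "U \<le> U\<^sub>0" "0 < \<delta>"
  shows "\<forall>\<^sub>F k in U. norm (X k) < \<delta>"
  using eventually_near[OF assms]
proof eventually_elim
  case (elim k)
  then show ?case using elim[rule_format, of "X k"] pos[of k] by simp
qed

lemma flat_germ_mult:
  assumes "germ S F" "(X \<longlongrightarrow> 0) U" "U \<le> U\<^sub>0" "flat U a"
  shows "flat U (\<lambda>k. F (X k) * a k)"
proof -
  obtain \<delta> B where "0 < \<delta>" and B: "\<And>x. norm x < \<delta> \<Longrightarrow> \<bar>F x\<bar> \<le> B" using germ_bounded[OF assms(1)] by blast
  have "\<forall>\<^sub>F k in U. \<bar>F (X k)\<bar> \<le> B"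
    using eventually_small[OF assms(2,3) \<open>0 < \<delta>\<close>] by eventually_elim (rule B)
  then show ?thesis by (rule flat_mult_bounded[OF assms(4,3)])
qed

lemma germ_zero_if_flat:
  assumes U: "U \<noteq> bot" "U \<le> U\<^sub>0" and X: "(X \<longlongrightarrow> 0) U" and F: "germ S F"
    and flat: "flat U (\<lambda>k. F (X k))"
  shows "F 0 = 0"
proof -
  obtain \<delta> L where "0 < \<delta>" and L: "\<And>x y. norm x < \<delta> \<Longrightarrow> norm y < \<delta> \<Longrightarrow> \<bar>F x - F y\<bar> \<le> L * norm (x - y)"
    using germ_lipschitz[OF F] by blast
  have le: "\<forall>\<^sub>F k in U. norm (F (X k) - F 0) \<le> L * norm (X k)"
    using eventually_small[OF X U(2) \<open>0 < \<delta>\<close>]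
  proof eventually_elim
    case (elim k)
    then show ?case using L[of "X k" 0] \<open>0 < \<delta>\<close> by simp
  qed
  have "((\<lambda>k. L * norm (X k)) \<longlongrightarrow> L * norm (0 :: real ^ 'a)) U"
    by (intro tendsto_mult_left tendsto_norm X)
  then have "((\<lambda>k. L * norm (X k)) \<longlongrightarrow> 0) U" by simp
  from Lim_null_comparison[OF le this] have 1: "((\<lambda>k. F (X k)) \<longlongrightarrow> F 0) U"
    by (rule Lim_null[THEN iffD2])
  have "\<forall>\<^sub>F k in U. norm (F (X k)) \<le> \<epsilon> k ^ 1" using flat unfolding flat_def real_norm_def by blast
  then have "\<forall>\<^sub>F k in U. norm (F (X k)) \<le> \<epsilon> k" by simp
  from Lim_null_comparison[OF this tendsto_mono[OF U(2) lim]] have "((\<lambda>k. F (X k)) \<longlongrightarrow> 0) U" .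
  with 1 U(1) show ?thesis using tendsto_unique by blast
qed

section \<open>Zeros near flat points\<close>

text \<open>
  Here \<open>W = poly_in t a q\<close> is flat of least degree, in the sense of the assumption on finer filters. A flat
  polynomial of degree less than \<open>q\<close> has only flat coefficients: if its top coefficient were not flat, it
  would be visible along a finer filter and contradict minimality, so it can be split off.
  A flat polynomial of degree at least \<open>q\<close> is reduced by one step of pseudo-division by \<open>W\<close>. The function
  \<open>G\<close> collects the coefficients of the final remainder as a sum of squares; its zeros are their
  common zeros.
\<close>
lemma eliminate_variable:
  fixes X :: "'k \<Rightarrow> real ^ 'n::finite"
  assumes U: "U \<noteq> bot" "U \<le> U\<^sub>0" and X: "(X \<longlongrightarrow> 0) U"
    and a: "\<And>k. k \<le> q \<Longrightarrow> germ S (a k)"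
    and flat_a: "flat U (\<lambda>k. poly_in t a q (X k))" and vis: "visible U (\<lambda>k. a q (X k))"
    and min: "\<And>V b n. V \<le> U \<Longrightarrow> V \<noteq> bot \<Longrightarrow> n < q \<Longrightarrow> (\<And>k. k \<le> n \<Longrightarrow> germ S (b k)) \<Longrightarrow>
      flat V (\<lambda>k. poly_in t b n (X k)) \<Longrightarrow> \<not> visible V (\<lambda>k. b n (X k))"
    and b: "\<And>k. k \<le> n \<Longrightarrow> germ S (b k)" and flat_b: "flat U (\<lambda>k. poly_in t b n (X k))"
  shows "\<exists>G. germ S G \<and> flat U (\<lambda>k. G (X k)) \<and>
    (\<forall>y. G y = 0 \<longrightarrow> a q y \<noteq> 0 \<longrightarrow> poly_in t a q y = 0 \<longrightarrow> poly_in t b n y = 0)"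
  using b flat_b
proof (induction n arbitrary: b)
  case 0
  then show ?case by (intro exI[of _ "b 0"]) (auto simp: poly_in_def)
next
  case (Suc n)
  have mon: "germ UNIV (\<lambda>x. x $ t ^ m)" for m by (intro germ_power germ_coord) simp
  show ?case
  proof (cases "Suc n < q")
    case True
    have top: "flat U (\<lambda>k. b (Suc n) (X k))"
    proof (rule ccontr)
      assume "\<not> ?thesis"
      then obtain V where V: "V \<le> U" "V \<noteq> bot" "visible V (\<lambda>k. b (Suc n) (X k))"
        using exists_visible_subfilter by blast
      then show False using min[of V "Suc n" b, OF V(1,2) True Suc.prems(1) flat_mono[OF Suc.prems(2) V(1)]] by blast
    qed
    have "flat U (\<lambda>k. poly_in t b (Suc n) (X k) - X k $ t ^ Suc n * b (Suc n) (X k))"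
      by (intro flat_diff Suc.prems(2) flat_germ_mult[OF mon X U(2) top] U(2))
    then have "flat U (\<lambda>k. poly_in t b n (X k))" by (simp add: poly_in_Suc mult.commute)
    with Suc.IH[of b] Suc.prems(1) obtain G where G: "germ S G" "flat U (\<lambda>k. G (X k))"
      "\<forall>y. G y = 0 \<longrightarrow> a q y \<noteq> 0 \<longrightarrow> poly_in t a q y = 0 \<longrightarrow> poly_in t b n y = 0" by auto
    let ?G = "\<lambda>x. G x * G x + b (Suc n) x * b (Suc n) x"
    have "germ S ?G" using G(1) Suc.prems(1) by (intro germ_add germ_mult) auto
    moreover have "flat U (\<lambda>k. ?G (X k))"
      using G Suc.prems(1)[of "Suc n"] top by (intro flat_add flat_germ_mult[OF _ X] U(2)) auto
    moreover have "poly_in t b (Suc n) y = 0" if "?G y = 0" "a q y \<noteq> 0" "poly_in t a q y = 0" for y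
      using that G(3) by (simp add: poly_in_Suc sum_squares_eq_zero_iff)
    ultimately show ?thesis by (intro exI[of _ ?G]) auto
  next
    case False
    define m where "m = Suc n - q"
    have m: "Suc n = m + q" using False by (simp add: m_def)
    define c where "c k = (if m \<le> k then a (k - m) else (\<lambda>_. 0))" for k
    \<comment> \<open>One step of pseudo-division: the terms of degree Suc n cancel.\<close>
    define b' where "b' k x = a q x * b k x - b (Suc n) x * c k x" for k x
    have c: "germ S (c k)" if "k \<le> Suc n" for k
      using a[of "k - m"] that m by (auto simp: c_def germ_const)
    have b': "germ S (b' k)" if "k \<le> Suc n" for k
      unfolding b'_def using that a c Suc.prems(1) by (intro germ_diff germ_mult) auto
    have eq: "poly_in t b' n y = a q y * poly_in t b (Suc n) y - b (Suc n) y * (y $ t ^ m * poly_in t a q y)" for y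
    proof -
      have "b' (Suc n) y = 0" using m by (simp add: b'_def c_def)
      then have "poly_in t b' n y = poly_in t b' (Suc n) y" by (simp add: poly_in_Suc)
      also have "\<dots> = a q y * poly_in t b (Suc n) y - b (Suc n) y * poly_in t c (Suc n) y"
        by (simp add: poly_in_def b'_def sum_subtractf sum_distrib_left left_diff_distrib mult.assoc del: sum.atMost_Suc)
      also have "poly_in t c (Suc n) y = y $ t ^ m * poly_in t a q y"
        unfolding c_def m by (rule poly_in_shift)
      finally show ?thesis .
    qed
    have "flat U (\<lambda>k. a q (X k) * poly_in t b (Suc n) (X k) - b (Suc n) (X k) * (X k $ t ^ m * poly_in t a q (X k)))"
      using a Suc.prems flat_a by (intro flat_diff flat_germ_mult[OF _ X] flat_germ_mult[OF mon X] U(2)) auto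
    then have "flat U (\<lambda>k. poly_in t b' n (X k))" by (simp add: eq)
    with Suc.IH[of b'] b' obtain G where G: "germ S G" "flat U (\<lambda>k. G (X k))"
      "\<forall>y. G y = 0 \<longrightarrow> a q y \<noteq> 0 \<longrightarrow> poly_in t a q y = 0 \<longrightarrow> poly_in t b' n y = 0" by auto
    then show ?thesis by (intro exI[of _ G]) (auto simp: eq)
  qed
qed

text \<open>
  Points \<open>z\<close> very close to \<open>X k\<close> inherit from \<open>X k\<close> that \<open>W = poly_in t a (Suc q)\<close> is tiny there while its
  derivative \<open>D\<close> with respect to the variable \<open>t\<close> and its leading coefficient are not, because all
  three are Lipschitz. Moving only the coordinate \<open>t\<close> then leads to a root of \<open>W\<close>, and leaves the
  coefficients of \<open>W\<close>, and every other function of the remaining variables, unchanged.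
\<close>
lemma eventually_move_to_root:
  fixes X :: "'k \<Rightarrow> real ^ 'n::finite" and a :: "nat \<Rightarrow> real ^ 'n \<Rightarrow> real"
  assumes U: "U \<le> U\<^sub>0" and X: "(X \<longlongrightarrow> 0) U" and t: "t \<in> S"
    and a: "\<And>k. k \<le> Suc q \<Longrightarrow> germ (S - {t}) (a k)"
    and flat_a: "flat U (\<lambda>k. poly_in t a (Suc q) (X k))"
    and vis_a: "visible U (\<lambda>k. a (Suc q) (X k))"
    and vis_D: "visible U (\<lambda>k. poly_in t (\<lambda>k x. real (Suc k) * a (Suc k) x) q (X k))"
  shows "\<exists>N'. \<forall>\<^sub>F k in U. \<forall>z. norm (z - X k) \<le> \<epsilon> k ^ N' \<longrightarrow>
    (\<exists>y. norm (y - X k) \<le> \<epsilon> k ^ N \<and> (\<forall>i\<in>S - {t}. y $ i = z $ i) \<and>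
      poly_in t a (Suc q) y = 0 \<and> a (Suc q) y \<noteq> 0)"
proof -
  define W where "W = poly_in t a (Suc q)"
  define D where "D = poly_in t (\<lambda>k x. real (Suc k) * a (Suc k) x) q"
  have gW: "germ S W" unfolding W_def using a t by (rule germ_poly_in)
  have gD: "germ S D" unfolding D_def
    by (rule germ_poly_in[OF _ t]) (intro germ_mult germ_const a, simp)
  obtain \<delta>W LW where \<delta>W: "0 < \<delta>W" "0 \<le> LW" "\<And>x y. norm x < \<delta>W \<Longrightarrow> norm y < \<delta>W \<Longrightarrow> \<bar>W x - W y\<bar> \<le> LW * norm (x - y)"
    using germ_lipschitz[OF gW] by blast
  obtain \<delta>D LD where \<delta>D: "0 < \<delta>D" "0 \<le> LD" "\<And>x y. norm x < \<delta>D \<Longrightarrow> norm y < \<delta>D \<Longrightarrow> \<bar>D x - D y\<bar> \<le> LD * norm (x - y)"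
    using germ_lipschitz[OF gD] by blast
  obtain \<delta>a La where \<delta>a: "0 < \<delta>a" "0 \<le> La"
      "\<And>x y. norm x < \<delta>a \<Longrightarrow> norm y < \<delta>a \<Longrightarrow> \<bar>a (Suc q) x - a (Suc q) y\<bar> \<le> La * norm (x - y)"
    using germ_lipschitz[OF a[OF order_refl]] by blast
  obtain \<rho> B where \<rho>B: "\<And>k. k \<le> Suc q \<Longrightarrow> series_on (\<chi> i. \<rho>) (S - {t}) (a k) B"
    using germ_common_radius_upto[of "Suc q" "S - {t}" a] a by blast
  have \<rho>: "0 < \<rho>" using series_on_pos[OF \<rho>B[of 0]] by simp
  have B0: "0 \<le> B" by (rule series_on_nonneg[OF \<rho>B[of 0]]) simp
  obtain M where M: "\<forall>\<^sub>F k in U. \<epsilon> k ^ M \<le> \<bar>D (X k)\<bar>" using vis_D unfolding visible_def D_def by blast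
  obtain A where A: "\<forall>\<^sub>F k in U. \<epsilon> k ^ A \<le> \<bar>a (Suc q) (X k)\<bar>" using vis_a unfolding visible_def by blast
  define C where "C = (\<Sum>k\<le>q. B * 4 ^ Suc k)"
  have C0: "0 \<le> C" unfolding C_def using B0 by (intro sum_nonneg) simp
  \<comment> \<open>The step in direction t is at most \<epsilon> ^ L. For it to find a root, W must be
    of size at most \<epsilon> ^ Q, where D is at least \<epsilon> ^ M / 2; the exponent N' keeps the values of W, D and
    the leading coefficient at z close enough to those at X k.\<close>
  define L where "L = Suc (Suc N + M)"
  define Q where "Q = Suc (M + L)"
  define N' where "N' = Suc (A + Q)"
  define \<delta> where "\<delta> = min (min \<delta>W \<delta>D) (min \<delta>a (min \<rho> 1))"
  have \<delta>: "0 < \<delta>" "\<delta> \<le> \<delta>W" "\<delta> \<le> \<delta>D" "\<delta> \<le> \<delta>a" "\<delta> \<le> \<rho>" "\<delta> \<le> 1" using \<delta>W(1) \<delta>D(1) \<delta>a(1) \<rho> by (auto simp: \<delta>_def)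
  have quarter: "\<forall>\<^sub>F k in U. K * \<epsilon> k ^ Suc n \<le> 1/4 * \<epsilon> k ^ n" for K n
    by (rule eventually_const_mult_le[OF U]) simp
  have "\<forall>\<^sub>F k in U. \<bar>W (X k)\<bar> \<le> \<epsilon> k ^ Suc Q" using flat_a unfolding flat_def W_def by blast
  moreover note M A eventually_near[OF X U \<delta>(1)] quarter[of 2 "Suc N"] quarter[of 1 "M + L"]
    quarter[of C M] quarter[of 1 Q] quarter[of LW Q] quarter[of LD M] quarter[of La A]
  ultimately have "\<forall>\<^sub>F k in U. \<forall>z. norm (z - X k) \<le> \<epsilon> k ^ N' \<longrightarrow>
    (\<exists>y. norm (y - X k) \<le> \<epsilon> k ^ N \<and> (\<forall>i\<in>S - {t}. y $ i = z $ i) \<and> W y = 0 \<and> a (Suc q) y \<noteq> 0)"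
  proof eventually_elim
    case (elim k)
    let ?e = "\<epsilon> k"
    have dec: "?e ^ m \<le> ?e ^ n" if "n \<le> m" for m n
      using that pos[of k] lt1[of k] by (intro power_decreasing) auto
    have ep: "0 < ?e ^ n" for n using pos[of k] by simp
    have near: "norm y < \<delta>" if "norm (y - X k) \<le> ?e" for y using elim(4) that by blast
    have Xk: "norm (X k) < \<delta>" using near[of "X k"] pos[of k] by simp
    show ?case
    proof (intro allI impI)
      fix z assume z: "norm (z - X k) \<le> ?e ^ N'"
      have zn: "norm z < \<delta>" using z dec[of 1 N'] by (intro near) (simp add: N'_def)
      have zL: "L' * norm (z - X k) \<le> L' * ?e ^ Suc n" if "0 \<le> L'" "Suc n \<le> N'" for L' n
        using z dec[OF that(2)] that(1) by (intro mult_left_mono) auto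
      have "\<bar>W z - W (X k)\<bar> \<le> LW * ?e ^ Suc Q"
        using \<delta>W(3)[of z "X k"] zn Xk \<delta> zL[OF \<delta>W(2), of Q] by (simp add: N'_def)
      then have Wz: "\<bar>W z\<bar> \<le> ?e ^ Q" using elim(1,8,9) ep[of Q] by linarith
      have "\<bar>D z - D (X k)\<bar> \<le> LD * ?e ^ Suc M"
        using \<delta>D(3)[of z "X k"] zn Xk \<delta> zL[OF \<delta>D(2), of M] by (simp add: N'_def Q_def)
      then have Dz: "?e ^ M / 2 \<le> \<bar>D z\<bar>" using elim(2,10) ep[of M] by linarith
      have "\<bar>a (Suc q) z - a (Suc q) (X k)\<bar> \<le> La * ?e ^ Suc A"
        using \<delta>a(3)[of z "X k"] zn Xk \<delta> zL[OF \<delta>a(2), of A] by (simp add: N'_def)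
      then have az: "a (Suc q) z \<noteq> 0" using elim(3,11) ep[of A] by linarith
      define \<eta> where "\<eta> = ?e ^ L"
      have \<eta>: "0 < \<eta>" "\<eta> \<le> 1" unfolding \<eta>_def using ep dec[of 0 L] by auto
      let ?y = "\<lambda>\<tau>. z + axis t \<tau>"
      let ?\<phi> = "\<lambda>\<tau>. \<Sum>k\<le>Suc q. a k z * (z $ t + \<tau>) ^ k"
      have yd: "norm (?y \<tau> - X k) \<le> ?e ^ Suc N" if "\<bar>\<tau>\<bar> \<le> \<eta>" for \<tau>
      proof -
        have "norm (?y \<tau> - X k) \<le> norm (z - X k) + norm (axis t \<tau> :: real ^ 'n)"
          using norm_triangle_ineq[of "z - X k" "axis t \<tau>"] by (simp add: algebra_simps)
        also have "norm (axis t \<tau> :: real ^ 'n) = \<bar>\<tau>\<bar>" by (simp add: norm_eq_sqrt_inner inner_axis_axis)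
        finally have "norm (?y \<tau> - X k) \<le> ?e ^ N' + ?e ^ L" using z that by (simp add: \<eta>_def)
        also have "\<dots> \<le> 2 * ?e ^ Suc (Suc N)"
          using dec[of "Suc (Suc N)" N'] dec[of "Suc (Suc N)" L] by (simp add: N'_def Q_def L_def)
        finally show ?thesis using elim(5) ep[of "Suc N"] by linarith
      qed
      have pd: "x \<in> polydisc (\<chi> i. \<rho>)" if "norm x < \<delta>" for x
        using polydisc_const_if_small[of x \<rho>] that \<delta> by simp
      have az': "a j (?y \<tau>) = a j z" if "j \<le> Suc q" "norm (?y \<tau>) < \<delta>" for j \<tau>
        by (rule series_on_depends[OF \<rho>B[OF that(1)]])
          (use pd[OF that(2)] pd[OF zn] in \<open>auto simp: axis_def\<close>)
      have W\<phi>: "W (?y \<tau>) = ?\<phi> \<tau>" if "norm (?y \<tau>) < \<delta>" for \<tau>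
        unfolding W_def poly_in_def using az'[OF _ that]
        by (intro sum.cong refl) (auto simp: axis_def)
      have D\<phi>: "D z = (\<Sum>k\<le>q. real (Suc k) * a (Suc k) z * z $ t ^ k)"
        by (simp add: D_def poly_in_def)
      have zt: "\<bar>z $ t\<bar> \<le> 1" using component_le_norm_cart[of z t] zn \<delta> by linarith
      have taylor: "\<bar>?\<phi> \<tau> - ?\<phi> 0 - D z * \<tau>\<bar> \<le> C * \<tau>\<^sup>2" if "\<bar>\<tau>\<bar> \<le> \<eta>" for \<tau>
      proof -
        have "\<bar>a j z\<bar> \<le> B" if "j \<le> Suc q" for j
          by (rule series_on_abs_le[OF \<rho>B[OF that]]) (rule pd[OF zn])
        from polynomial_taylor_bound[OF this zt, where \<tau> = \<tau>] show ?thesis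
          unfolding D\<phi> C_def using that \<eta> by simp
      qed
      have y0: "?y 0 = z" by (simp add: axis_def vec_eq_iff)
      have "norm (?y 0) < \<delta>" unfolding y0 by (rule zn)
      from W\<phi>[OF this] have "?\<phi> 0 = W z" unfolding y0 by (rule sym)
      then have "\<bar>?\<phi> 0\<bar> \<le> ?e ^ Q" using Wz by simp
      also have "\<dots> \<le> (1/4) * (?e ^ M * \<eta>)" using elim(6) by (simp add: Q_def \<eta>_def power_add)
      finally have 1: "\<bar>?\<phi> 0\<bar> \<le> (1/4) * (?e ^ M * \<eta>)" .
      have "C * \<eta> \<le> C * ?e ^ Suc M" unfolding \<eta>_def using dec[of "Suc M" L] C0 by (intro mult_left_mono) (auto simp: L_def)
      then have "C * \<eta> \<le> (1/4) * ?e ^ M" using elim(7) by linarith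
      then have 2: "C * \<eta>\<^sup>2 \<le> (1/4) * (?e ^ M * \<eta>)"
        using mult_right_mono[of "C * \<eta>" "(1/4) * ?e ^ M" \<eta>] \<eta> by (simp add: power2_eq_square mult.assoc)
      have 3: "(1/2) * (?e ^ M * \<eta>) \<le> \<bar>D z\<bar> * \<eta>"
        using mult_right_mono[OF Dz, of \<eta>] \<eta> by simp
      have "continuous_on {-\<eta>..\<eta>} ?\<phi>" by (intro continuous_intros)
      from root_near_simple_approximate_root[OF this \<eta>(1) taylor] 1 2 3
      obtain \<tau> where \<tau>: "\<bar>\<tau>\<bar> \<le> \<eta>" "?\<phi> \<tau> = 0" by fastforce
      have "norm (?y \<tau> - X k) \<le> ?e" using yd[OF \<tau>(1)] dec[of 1 "Suc N"] by simp
      then have yn: "norm (?y \<tau>) < \<delta>" by (rule near)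
      show "\<exists>y. norm (y - X k) \<le> ?e ^ N \<and> (\<forall>i\<in>S - {t}. y $ i = z $ i) \<and> W y = 0 \<and> a (Suc q) y \<noteq> 0"
        using order_trans[OF yd[OF \<tau>(1)] dec[of N "Suc N"]] W\<phi>[OF yn] \<tau>(2) az az'[OF order_refl yn]
        by (intro exI[of _ "?y \<tau>"]) (auto simp: axis_def)
    qed
  qed
  then show ?thesis unfolding W_def by blast
qed

text \<open>
  The inductive step when Weierstrass preparation applies directly. The assumption \<open>lower\<close> is the induction
  hypothesis for one variable less.
\<close>
lemma zero_near_flat_point_regular:
  fixes X :: "'k \<Rightarrow> real ^ 'n::finite"
  assumes U: "U \<noteq> bot" "U \<le> U\<^sub>0" and X: "(X \<longlongrightarrow> 0) U"
    and F: "series_on r S F B" and flat_F: "flat U (\<lambda>k. F (X k))"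
    and t: "t \<in> S" and z: "axis t z \<in> polydisc r" "F (axis t z) \<noteq> 0"
    and lower: "\<And>V G N. V \<noteq> bot \<Longrightarrow> V \<le> U \<Longrightarrow> germ (S - {t}) G \<Longrightarrow> flat V (\<lambda>k. G (X k)) \<Longrightarrow>
      \<exists>\<^sub>F k in V. \<exists>y. norm (y - X k) \<le> \<epsilon> k ^ N \<and> G y = 0"
  shows "\<exists>\<^sub>F k in U. \<exists>y. norm (y - X k) \<le> \<epsilon> k ^ N \<and> F y = 0"
proof -
  obtain r' p v s B' where r': "\<And>i. 0 < r' $ i" and v: "series_on r' S v B'"
    and s: "\<And>k. k < p \<Longrightarrow> \<exists>B'. series_on r' (S - {t}) (s k) B'"
    and vF: "\<And>x. x \<in> polydisc r' \<Longrightarrow> v x \<noteq> 0 \<and> v x * F x = x $ t ^ p + (\<Sum>k<p. s k x * x $ t ^ k)"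
    using weierstrass_preparation[OF F z] by blast
  \<comment> \<open>The distinguished polynomial v * F, with leading coefficient 1.\<close>
  define b where "b k = (if k < p then s k else (\<lambda>_. 1))" for k
  have gb: "germ (S - {t}) (b k)" for k
    using s[of k] by (auto simp: b_def intro: germI germ_const)
  have poly_b: "poly_in t b p x = v x * F x" if "x \<in> polydisc r'" for x
  proof -
    have "poly_in t b p x = (\<Sum>k<p. b k x * x $ t ^ k) + b p x * x $ t ^ p"
      unfolding poly_in_def by (simp add: lessThan_Suc_atMost[symmetric])
    also have "(\<Sum>k<p. b k x * x $ t ^ k) = (\<Sum>k<p. s k x * x $ t ^ k)" by (simp add: b_def)
    moreover have "b p x = 1" by (simp add: b_def)
    ultimately show ?thesis using vF[OF that] by simp
  qed
  have evX: "\<forall>\<^sub>F k in U. P (X k)" if "\<forall>\<^sub>F x in nhds 0. P x" for P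
    using X that unfolding filterlim_iff by blast
  have "flat U (\<lambda>k. v (X k) * F (X k))" by (rule flat_germ_mult[OF germI[OF v] X U(2) flat_F])
  then have flat_b: "flat U (\<lambda>k. poly_in t b p (X k))"
    by (rule flat_cong[rotated]) (rule eventually_mono[OF evX[OF eventually_polydisc[OF r']]], simp add: poly_b)
  have vis_b: "visible U (\<lambda>k. b p (X k))" unfolding visible_def b_def by (rule exI[of _ 0]) simp
  define P where "P q \<longleftrightarrow> (\<exists>V a. V \<le> U \<and> V \<noteq> bot \<and> (\<forall>k\<le>q. germ (S - {t}) (a k)) \<and>
      flat V (\<lambda>k. poly_in t a q (X k)) \<and> visible V (\<lambda>k. a q (X k)))" for q
  have "P p" unfolding P_def using U gb flat_b vis_b by blast
  define q where "q = (LEAST q. P q)"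
  have "P q" unfolding q_def using \<open>P p\<close> by (rule LeastI)
  then obtain V a where V: "V \<le> U" "V \<noteq> bot" and ga: "\<And>k. k \<le> q \<Longrightarrow> germ (S - {t}) (a k)"
    and flat_a: "flat V (\<lambda>k. poly_in t a q (X k))" and vis_a: "visible V (\<lambda>k. a q (X k))"
    unfolding P_def by blast
  have minimal: "\<not> P n" if "n < q" for n using that not_less_Least unfolding q_def by blast
  have VU: "V \<le> U\<^sub>0" using V(1) U(2) by (rule order_trans)
  have XV: "(X \<longlongrightarrow> 0) V" using X V(1) by (rule tendsto_mono[rotated])
  have "q \<noteq> 0"
  proof
    assume "q = 0"
    then have "flat V (\<lambda>k. a q (X k))" using flat_a by (simp add: poly_in_def)
    then show False using vis_a V(2) by (rule flat_not_visible)
  qed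
  then obtain q' where q': "q = Suc q'" using not0_implies_Suc by blast
  let ?a' = "\<lambda>k x. real (Suc k) * a (Suc k) x"
  \<comment> \<open>The derivative has a visible leading coefficient and smaller degree, so by minimality it is flat along no finer filter.\<close>
  have vis_D: "visible V (\<lambda>k. poly_in t ?a' q' (X k))"
  proof (rule ccontr)
    assume "\<not> ?thesis"
    then obtain V' where V': "V' \<le> V" "V' \<noteq> bot" "flat V' (\<lambda>k. poly_in t ?a' q' (X k))"
      using exists_flat_subfilter by blast
    obtain M where "\<forall>\<^sub>F k in V'. \<epsilon> k ^ M \<le> \<bar>a q (X k)\<bar>"
      using visible_mono[OF vis_a V'(1)] unfolding visible_def by blast
    then have "\<forall>\<^sub>F k in V'. \<epsilon> k ^ M \<le> \<bar>?a' q' (X k)\<bar>"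
    proof eventually_elim
      case (elim k)
      have "1 * \<bar>a q (X k)\<bar> \<le> real (Suc q') * \<bar>a q (X k)\<bar>" by (rule mult_right_mono) auto
      with elim show ?case by (simp only: q' abs_mult abs_of_nat mult_1)
    qed
    then have "visible V' (\<lambda>k. ?a' q' (X k))" unfolding visible_def by blast
    moreover have "\<forall>k\<le>q'. germ (S - {t}) (?a' k)" using ga q' by (auto intro!: germ_mult germ_const)
    ultimately have "P q'" unfolding P_def
      by (intro exI[of _ V'] exI[of _ ?a'] conjI order_trans[OF V'(1) V(1)] V'(2,3))
    then show False using minimal[of q'] q' by simp
  qed
  obtain G where G: "germ (S - {t}) G" "flat V (\<lambda>k. G (X k))"
    "\<And>y. G y = 0 \<Longrightarrow> a q y \<noteq> 0 \<Longrightarrow> poly_in t a q y = 0 \<Longrightarrow> poly_in t b p y = 0"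
  proof -
    have "\<exists>G. germ (S - {t}) G \<and> flat V (\<lambda>k. G (X k)) \<and>
      (\<forall>y. G y = 0 \<longrightarrow> a q y \<noteq> 0 \<longrightarrow> poly_in t a q y = 0 \<longrightarrow> poly_in t b p y = 0)"
    proof (rule eliminate_variable[OF V(2) VU XV ga flat_a vis_a _ gb flat_mono[OF flat_b V(1)]])
      fix V' c n
      assume "V' \<le> V" "V' \<noteq> bot" "n < q" "\<And>k. k \<le> n \<Longrightarrow> germ (S - {t}) (c k)"
        "flat V' (\<lambda>k. poly_in t c n (X k))"
      then show "\<not> visible V' (\<lambda>k. c n (X k))"
        using minimal[of n] order_trans[OF _ V(1)] unfolding P_def by blast
    qed
    then show ?thesis using that by blast
  qed
  obtain \<delta> where \<delta>: "0 < \<delta>" "\<And>x y. norm x < \<delta> \<Longrightarrow> norm y < \<delta> \<Longrightarrow> \<forall>i\<in>S - {t}. x $ i = y $ i \<Longrightarrow> G x = G y"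
    using germ_depends[OF G(1)] by blast
  obtain \<delta>' where \<delta>': "0 < \<delta>'" "\<And>x. norm x < \<delta>' \<Longrightarrow> x \<in> polydisc r'"
    using eventually_polydisc[OF r'] unfolding eventually_nhds_metric dist_norm by auto
  obtain N' where N': "\<forall>\<^sub>F k in V. \<forall>z. norm (z - X k) \<le> \<epsilon> k ^ N' \<longrightarrow>
    (\<exists>y. norm (y - X k) \<le> \<epsilon> k ^ Suc N \<and> (\<forall>i\<in>S - {t}. y $ i = z $ i) \<and>
      poly_in t a q y = 0 \<and> a q y \<noteq> 0)"
    using eventually_move_to_root[OF VU XV t, of q' a "Suc N"] ga flat_a vis_a vis_D unfolding q' by blast
  have "\<exists>\<^sub>F k in V. \<exists>z. norm (z - X k) \<le> \<epsilon> k ^ Suc N' \<and> G z = 0"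
    by (rule lower[OF V(2,1) G(1,2)])
  moreover have "\<forall>\<^sub>F k in V. (\<exists>z. norm (z - X k) \<le> \<epsilon> k ^ Suc N' \<and> G z = 0) \<longrightarrow>
      (\<exists>y. norm (y - X k) \<le> \<epsilon> k ^ N \<and> F y = 0)"
    using N' eventually_near[OF XV VU \<delta>(1)] eventually_near[OF XV VU \<delta>'(1)]
  proof eventually_elim
    case (elim k)
    have dec: "\<epsilon> k ^ m \<le> \<epsilon> k ^ n" if "n \<le> m" for m n
      using that pos[of k] lt1[of k] by (intro power_decreasing) auto
    show ?case
    proof (intro impI, elim exE conjE)
      fix z assume z: "norm (z - X k) \<le> \<epsilon> k ^ Suc N'" "G z = 0"
      have "norm (z - X k) \<le> \<epsilon> k ^ N'" "norm (z - X k) \<le> \<epsilon> k"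
        using z(1) dec[of N' "Suc N'"] dec[of 1 "Suc N'"] by auto
      then obtain y where y: "norm (y - X k) \<le> \<epsilon> k ^ Suc N" "\<forall>i\<in>S - {t}. y $ i = z $ i"
        "poly_in t a q y = 0" "a q y \<noteq> 0" and zn: "norm z < \<delta>" using elim(1,2) by blast
      have "norm (y - X k) \<le> \<epsilon> k" using y(1) dec[of 1 "Suc N"] by simp
      then have yn: "norm y < \<delta>" "y \<in> polydisc r'" using elim(2,3) \<delta>'(2) by blast+
      have "G y = 0" using \<delta>(2)[OF yn(1) zn y(2)] z(2) by simp
      then have "v y * F y = 0" using G(3)[OF _ y(4,3)] poly_b[OF yn(2)] by simp
      moreover have "v y \<noteq> 0" using vF[OF yn(2)] by blast
      ultimately have "F y = 0" by simp
      then show "\<exists>y. norm (y - X k) \<le> \<epsilon> k ^ N \<and> F y = 0"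
        using order_trans[OF y(1) dec[of N "Suc N"]] by auto
    qed
  qed
  ultimately have "\<exists>\<^sub>F k in V. \<exists>y. norm (y - X k) \<le> \<epsilon> k ^ N \<and> F y = 0"
    by (rule frequently_rev_mp)
  then show ?thesis using V(1) by (rule frequently_filter_mono)
qed

text \<open>
  A function that is not identically zero near \<open>0\<close> is nonzero at some small \<open>v\<close>, and a shear moves \<open>v\<close> to
  the \<open>t\<close>-axis. Choosing for \<open>t\<close> the index in \<open>S\<close> with the largest \<open>\<bar>v $ t\<bar>\<close> makes all slopes of the
  shear at most \<open>1\<close>. Then the sheared series still converges on the halved polydisc, which contains
  the image of \<open>v\<close>.
\<close>
lemma zero_near_flat_point:
  fixes X :: "'k \<Rightarrow> real ^ 'n::finite"
  assumes "U \<noteq> bot" "U \<le> U\<^sub>0" "(X \<longlongrightarrow> 0) U" "germ S F" "flat U (\<lambda>k. F (X k))"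
  shows "\<exists>\<^sub>F k in U. \<exists>y. norm (y - X k) \<le> \<epsilon> k ^ N \<and> F y = 0"
  using assms
proof (induction "card S" arbitrary: S U X F N rule: less_induct)
  case less
  note U = less.prems(1,2) and X = less.prems(3)
  show ?case
  proof (cases "\<forall>\<^sub>F x in nhds 0. F x = 0")
    case True
    then have "\<forall>\<^sub>F k in U. F (X k) = 0" using X unfolding filterlim_iff by blast
    then have "\<forall>\<^sub>F k in U. \<exists>y. norm (y - X k) \<le> \<epsilon> k ^ N \<and> F y = 0"
    proof eventually_elim
      case (elim k)
      then show ?case using pos[of k] by (intro exI[of _ "X k"]) simp
    qed
    then show ?thesis using U(1) by (intro eventually_frequently)
  next
    case False
    obtain \<rho> B where F: "series_on (\<chi> i. \<rho>) S F B" using less.prems(4) unfolding germ_def by blast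
    have \<rho>: "0 < \<rho>" using series_on_pos[OF F] by simp
    have F0: "F 0 = 0" using germ_zero_if_flat less.prems by blast
    have "\<forall>\<^sub>F x in nhds (0 :: real ^ 'n). x \<in> polydisc (\<chi> i. \<rho> / 2)"
      by (rule eventually_polydisc) (use \<rho> in simp)
    then obtain v where v: "F v \<noteq> 0" "v \<in> polydisc (\<chi> i. \<rho> / 2)"
      using False by (metis (mono_tags, lifting) eventually_mono)
    have v': "v \<in> polydisc (\<chi> i. \<rho>)"
      using v(2) polydisc_mono[of "\<chi> i. \<rho> / 2" "\<chi> i. \<rho>"] \<rho> by auto
    have "\<exists>i\<in>S. v $ i \<noteq> 0"
    proof (rule ccontr)
      assume "\<not> ?thesis"
      then have "F v = F 0" using v' \<rho>
        by (intro series_on_depends[OF F]) (auto simp: polydisc_def)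
      then show False using v F0 by simp
    qed
    then obtain i0 where i0: "i0 \<in> S" "v $ i0 \<noteq> 0" by blast
    let ?m = "Max ((\<lambda>i. \<bar>v $ i\<bar>) ` S)"
    have "?m \<in> (\<lambda>i. \<bar>v $ i\<bar>) ` S" using i0 by (intro Max_in) auto
    then obtain t where t: "t \<in> S" "?m = \<bar>v $ t\<bar>" by auto
    have max: "\<bar>v $ i\<bar> \<le> \<bar>v $ t\<bar>" if "i \<in> S" for i
      unfolding t(2)[symmetric] using that by (intro Max_ge) auto
    have vt: "v $ t \<noteq> 0" using max[OF i0(1)] i0(2) by auto
    define w where "w i = (if i \<in> S - {t} then v $ i / v $ t else 0)" for i
    have w: "\<bar>w i\<bar> \<le> 1" "w t = 0" for i using max[of i] vt by (auto simp: w_def divide_simps)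
    let ?F = "\<lambda>x. F (shear t w x)" and ?X = "\<lambda>k. shear t (\<lambda>i. - w i) (X k)"
    have F': "series_on (\<chi> i. \<rho> / 2) S ?F B" by (rule series_on_shear[OF F t(1) w(1)])
    have sX: "shear t w (?X k) = X k" for k by (simp add: shear_inverse w(2))
    have "((\<lambda>k. (2 * real CARD('n)) * norm (X k)) \<longlongrightarrow> (2 * real CARD('n)) * norm (0 :: real ^ 'n)) U"
      by (intro tendsto_mult_left tendsto_norm X)
    then have lim0: "((\<lambda>k. (2 * real CARD('n)) * norm (X k)) \<longlongrightarrow> 0) U" by simp
    have "norm (?X k) \<le> (2 * real CARD('n)) * norm (X k)" for k
      by (rule norm_shear_le) (simp add: w(1))
    then have X': "(?X \<longlongrightarrow> 0) U"
      by (intro Lim_null_comparison[OF always_eventually lim0] allI)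
    have comp: "shear t w (axis t (v $ t)) $ i = (if i \<in> S then v $ i else 0)" for i
      using vt t(1) by (cases "i = t") (simp_all add: shear_def axis_def w_def)
    have "F (shear t w (axis t (v $ t))) = F v"
    proof (rule series_on_depends[OF F _ v'])
      show "shear t w (axis t (v $ t)) \<in> polydisc (\<chi> i. \<rho>)"
        using v' \<rho> by (simp add: polydisc_def comp)
    qed (simp add: comp)
    then have nz: "?F (axis t (v $ t)) \<noteq> 0" using v by simp
    have ax: "axis t (v $ t) \<in> polydisc (\<chi> i. \<rho> / 2)"
      using v(2) \<rho> by (auto simp: polydisc_def axis_def)
    have flat': "flat U (\<lambda>k. ?F (?X k))" unfolding sX by (rule less.prems(5))
    have "card (S - {t}) < card S" using t(1) by (intro card_Diff1_less) auto
    then have lower: "\<exists>\<^sub>F k in V. \<exists>y. norm (y - ?X k) \<le> \<epsilon> k ^ M \<and> G y = 0"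
      if "V \<noteq> bot" "V \<le> U" "germ (S - {t}) G" "flat V (\<lambda>k. G (?X k))" for V G M
      using less.hyps[of "S - {t}" V ?X G M] that order_trans[OF that(2) U(2)] tendsto_mono[OF that(2) X'] by blast
    have "\<exists>\<^sub>F k in U. \<exists>y. norm (y - ?X k) \<le> \<epsilon> k ^ Suc N \<and> ?F y = 0"
      by (rule zero_near_flat_point_regular[OF U X' F' flat' t(1) ax nz lower])
    moreover have "\<forall>\<^sub>F k in U. (2 * real CARD('n)) * \<epsilon> k ^ Suc N \<le> 1 * \<epsilon> k ^ N"
      by (rule eventually_const_mult_le[OF U(2)]) simp
    then have "\<forall>\<^sub>F k in U. (\<exists>y. norm (y - ?X k) \<le> \<epsilon> k ^ Suc N \<and> ?F y = 0) \<longrightarrow>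
        (\<exists>y. norm (y - X k) \<le> \<epsilon> k ^ N \<and> F y = 0)"
    proof eventually_elim
      case (elim k)
      show ?case
      proof (intro impI, elim exE conjE)
        fix y assume y: "norm (y - ?X k) \<le> \<epsilon> k ^ Suc N" "?F y = 0"
        have "shear t w y - X k = shear t w (y - ?X k)" by (simp add: shear_diff sX)
        then have "norm (shear t w y - X k) \<le> (2 * real CARD('n)) * norm (y - ?X k)"
          using norm_shear_le[OF w(1)] by simp
        also have "\<dots> \<le> (2 * real CARD('n)) * \<epsilon> k ^ Suc N" using y(1) by (intro mult_left_mono) auto
        finally show "\<exists>y. norm (y - X k) \<le> \<epsilon> k ^ N \<and> F y = 0"
          using elim y(2) by (intro exI[of _ "shear t w y"]) auto
      qed
    qed
    ultimately show ?thesis by (rule frequently_rev_mp)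
  qed
qed

end

section \<open>The inequality and the polynomial\<close>

lemma abs_monomial_at_le_norm_power:
  fixes x :: "real ^ 'n::finite"
  shows "\<bar>monomial_at \<alpha> x\<bar> \<le> norm x ^ (\<Sum>i\<in>UNIV. Poly_Mapping.lookup \<alpha> i)"
  unfolding monomial_at_def power_sum abs_prod power_abs
  by (intro prod_mono) (simp add: power_mono component_le_norm_cart)

lemma finite_bounded_degree: "finite {\<alpha> :: 'n::finite \<Rightarrow>\<^sub>0 nat. (\<Sum>i\<in>UNIV. Poly_Mapping.lookup \<alpha> i) \<le> K}"
proof (rule finite_imageD)
  let ?A = "{\<alpha> :: 'n \<Rightarrow>\<^sub>0 nat. (\<Sum>i\<in>UNIV. Poly_Mapping.lookup \<alpha> i) \<le> K}"
  have "Poly_Mapping.lookup \<alpha> i \<le> K" if "\<alpha> \<in> ?A" for \<alpha> i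
    using that member_le_sum[of i UNIV "Poly_Mapping.lookup \<alpha>"] by auto
  then have "Poly_Mapping.lookup ` ?A \<subseteq> PiE UNIV (\<lambda>_. {..K})" by auto
  then show "finite (Poly_Mapping.lookup ` ?A)"
    by (rule finite_subset) (intro finite_PiE, auto)
  show "inj_on Poly_Mapping.lookup ?A" by (auto intro!: inj_onI poly_mapping_eqI)
qed

lemma convergent_near_0_summable_const:
  fixes f :: "'n::finite power_series"
  assumes "convergent_near_0 f"
  shows "\<exists>\<rho>>0. (\<lambda>\<alpha>. \<bar>f \<alpha>\<bar> * monomial_at \<alpha> (\<chi> i. \<rho>)) summable_on UNIV"
proof -
  obtain \<delta> where \<delta>: "0 < \<delta>" "\<And>x. norm x < \<delta> \<Longrightarrow> (\<lambda>\<alpha>. f \<alpha> * monomial_at \<alpha> x) summable_on UNIV"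
    using assms unfolding convergent_near_0_def eventually_nhds_metric dist_norm by auto
  define \<rho> where "\<rho> = \<delta> / (2 * real CARD('n))"
  have \<rho>: "0 < \<rho>" using \<delta>(1) by (simp add: \<rho>_def)
  let ?r = "\<chi> i. \<rho> :: real ^ 'n"
  have "norm ?r \<le> (\<Sum>i\<in>UNIV. \<bar>?r $ i\<bar>)" by (rule norm_le_l1_cart)
  also have "\<dots> = \<delta> / 2" using \<delta>(1) by (simp add: \<rho>_def)
  finally have "norm ?r < \<delta>" using \<delta>(1) by simp
  then have "(\<lambda>\<alpha>. norm (f \<alpha> * monomial_at \<alpha> ?r)) summable_on UNIV"
    by (intro summable_on_iff_abs_summable_on_real[THEN iffD1] \<delta>(2))
  moreover have "norm (f \<alpha> * monomial_at \<alpha> ?r) = \<bar>f \<alpha>\<bar> * monomial_at \<alpha> ?r" for \<alpha>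
    using monomial_at_nonneg[of ?r \<alpha>] \<rho> by (simp add: abs_mult)
  ultimately show ?thesis using \<rho> by auto
qed

lemma series_eval_has_sum:
  assumes "(\<lambda>\<alpha>. \<bar>f \<alpha>\<bar> * monomial_at \<alpha> r) summable_on UNIV" "x \<in> polydisc r"
  shows "((\<lambda>\<alpha>. f \<alpha> * monomial_at \<alpha> x) has_sum series_eval f x) UNIV"
  unfolding series_eval_def
  by (intro has_sum_infsum has_sum_norm_summable[OF assms(1)])
    (auto simp: abs_mult intro!: mult_left_mono abs_monomial_at_le assms(2))

lemma germ_series_eval:
  fixes f :: "'n::finite power_series"
  assumes "convergent_near_0 f"
  shows "germ UNIV (series_eval f)"
proof -
  obtain \<rho> where \<rho>: "0 < \<rho>" and sm: "(\<lambda>\<alpha>. \<bar>f \<alpha>\<bar> * monomial_at \<alpha> (\<chi> i. \<rho>)) summable_on UNIV"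
    using convergent_near_0_summable_const[OF assms] by blast
  show ?thesis
    by (rule germI, rule series_onI[OF _ _ has_sum_infsum[OF sm] order_refl])
      (use \<rho> series_eval_has_sum[OF sm] in auto)
qed

text \<open>
  If no \<open>K\<close> works, choose for each \<open>k\<close> a counterexample \<open>X k\<close> to the exponent \<open>k + 1\<close>; it is nonzero because
  equality holds at \<open>0\<close>. The true zeros near the \<open>X k\<close> are too close to \<open>X k\<close> to be \<open>0\<close>.
\<close>
lemma lojasiewicz_isolated_zero:
  fixes F :: "real ^ 'n::finite \<Rightarrow> real"
  assumes F: "germ UNIV F" and F0: "F 0 = 0" and pos: "\<forall>\<^sub>F x in at 0. 0 < F x"
  shows "\<exists>K>0. F \<succsim> (\<lambda>x. norm x ^ K)"
proof (rule ccontr)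
  assume none: "\<not> ?thesis"
  from pos have "\<exists>\<delta>>0. \<forall>x. x \<noteq> 0 \<and> dist x 0 < \<delta> \<longrightarrow> 0 < F x"
    by (simp add: eventually_at)
  then obtain \<delta> where \<delta>: "0 < \<delta>" "\<forall>x. x \<noteq> 0 \<and> dist x 0 < \<delta> \<longrightarrow> 0 < F x" by (elim exE conjE)
  have \<delta>F: "0 < F x" if "x \<noteq> 0" "norm x < \<delta>" for x
    using \<delta>(2) that by (simp add: dist_norm)
  have "\<exists>x. x \<noteq> 0 \<and> norm x < 1 / real (k + 2) \<and> norm x < \<delta> \<and> F x < norm x ^ Suc k" for k
  proof (rule ccontr)
    assume *: "\<not> ?thesis"
    have "\<forall>x :: real ^ 'n. dist x 0 < min \<delta> (1 / real (k + 2)) \<longrightarrow> 1 * norm x ^ Suc k \<le> F x"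
    proof (intro allI impI)
      fix x :: "real ^ 'n" assume "dist x 0 < min \<delta> (1 / real (k + 2))"
      with * show "1 * norm x ^ Suc k \<le> F x" by (cases "x = 0") (auto simp: F0 not_less)
    qed
    moreover have "0 < min \<delta> (1 / real (k + 2))" using \<delta> by simp
    ultimately have "\<forall>\<^sub>F x in nhds 0. 1 * norm x ^ Suc k \<le> F x"
      unfolding eventually_nhds_metric by blast
    then have "F \<succsim> (\<lambda>x. norm x ^ Suc k)"
      unfolding gtrsim_def by (intro exI[of _ 1]) auto
    with none show False by blast
  qed
  then obtain X where X: "\<And>k. X k \<noteq> 0" "\<And>k. norm (X k) < 1 / real (k + 2)" "\<And>k. norm (X k) < \<delta>"
    "\<And>k. F (X k) < norm (X k) ^ Suc k" by metis
  let ?\<epsilon> = "\<lambda>k. norm (X k)"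
  have lt1: "?\<epsilon> k < 1" for k
  proof -
    have "1 / real (k + 2) \<le> 1" by simp
    with X(2)[of k] show ?thesis by linarith
  qed
  have "(\<lambda>k. 1 / real (k + 2)) \<longlonglongrightarrow> 0"
    using LIMSEQ_ignore_initial_segment[OF lim_inverse_n, of 2] by (simp add: inverse_eq_divide)
  then have lim\<epsilon>: "?\<epsilon> \<longlonglongrightarrow> 0"
    by (rule Lim_null_comparison[rotated]) (use X(2) in \<open>auto intro!: always_eventually less_imp_le\<close>)
  interpret infinitesimal ?\<epsilon> sequentially
    by standard (use X(1) lt1 lim\<epsilon> in auto)
  have X0: "X \<longlonglongrightarrow> 0" using lim\<epsilon> tendsto_norm_zero_iff by blast
  have "flat sequentially (\<lambda>k. F (X k))" unfolding flat_def
  proof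
    fix N
    show "\<forall>\<^sub>F k in sequentially. \<bar>F (X k)\<bar> \<le> ?\<epsilon> k ^ N"
      using eventually_ge_at_top[of N]
    proof eventually_elim
      case (elim k)
      have "?\<epsilon> k ^ Suc k \<le> ?\<epsilon> k ^ N" using elim lt1[of k] by (intro power_decreasing) auto
      then show ?case using X(4)[of k] \<delta>F[OF X(1,3)[of k]] by simp
    qed
  qed
  from zero_near_flat_point[OF _ order_refl X0 F this, of 2]
  have "\<exists>\<^sub>F k in sequentially. \<exists>y. norm (y - X k) \<le> ?\<epsilon> k ^ 2 \<and> F y = 0" by simp
  with eventually_near[OF X0 order_refl \<delta>(1)]
  have "\<exists>\<^sub>F k in sequentially. (\<exists>y. norm (y - X k) \<le> ?\<epsilon> k ^ 2 \<and> F y = 0) \<and>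
      (\<forall>y. norm (y - X k) \<le> ?\<epsilon> k \<longrightarrow> norm y < \<delta>)"
    by (intro frequently_eventually_frequently)
  then obtain k y where y: "norm (y - X k) \<le> ?\<epsilon> k ^ 2" "F y = 0"
    and near: "\<And>y. norm (y - X k) \<le> ?\<epsilon> k \<Longrightarrow> norm y < \<delta>"
    using frequently_ex by blast
  have sq: "?\<epsilon> k ^ 2 < ?\<epsilon> k" using X(1)[of k] lt1[of k] by (simp add: power2_eq_square)
  have "y \<noteq> 0" using y(1) sq by auto
  moreover have "norm y < \<delta>" by (rule near) (use y(1) sq in linarith)
  ultimately show False using \<delta>F[of y] y(2) by simp
qed

text \<open>
  Terms of degree greater than \<open>K\<close> shrink at least by \<open>(norm x / \<rho>) ^ (K + 1)\<close> relative to their weight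
  at radius \<open>\<rho>\<close>.
\<close>
lemma taylor_polynomial_remainder:
  fixes f :: "'n::finite power_series"
  assumes "convergent_near_0 f"
  shows "\<exists>(g :: 'n polynomial) C. 0 \<le> C \<and>
    (\<forall>\<^sub>F x in nhds 0. \<bar>poly_eval g x - series_eval f x\<bar> \<le> C * norm x ^ Suc K)"
proof -
  let ?deg = "\<lambda>\<alpha> :: 'n \<Rightarrow>\<^sub>0 nat. \<Sum>i\<in>UNIV. Poly_Mapping.lookup \<alpha> i"
  let ?h = "\<lambda>\<alpha>. if ?deg \<alpha> \<le> K then f \<alpha> else 0"
  obtain \<rho> where \<rho>: "0 < \<rho>" and sm: "(\<lambda>\<alpha>. \<bar>f \<alpha>\<bar> * monomial_at \<alpha> (\<chi> i. \<rho>)) summable_on UNIV"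
    using convergent_near_0_summable_const[OF assms] by blast
  let ?r = "\<chi> i. \<rho> :: real ^ 'n"
  let ?M = "infsum (\<lambda>\<alpha>. \<bar>f \<alpha>\<bar> * monomial_at \<alpha> ?r) UNIV"
  have r0: "0 \<le> monomial_at \<alpha> ?r" for \<alpha> using \<rho> by (intro monomial_at_nonneg) simp
  have r: "monomial_at \<alpha> ?r = \<rho> ^ ?deg \<alpha>" for \<alpha> by (simp add: monomial_at_def power_sum)
  have fin: "finite {\<alpha>. ?h \<alpha> \<noteq> 0}" by (rule finite_subset[OF _ finite_bounded_degree[of K]]) auto
  define g :: "'n polynomial" where "g = Abs_poly_mapping ?h"
  have g: "Poly_Mapping.lookup g = ?h"
    unfolding g_def by (rule lookup_Abs_poly_mapping[OF fin])
  have smh: "(\<lambda>\<alpha>. \<bar>?h \<alpha>\<bar> * monomial_at \<alpha> ?r) summable_on UNIV"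
    by (rule summable_on_comparison_test[OF sm]) (auto intro: mult_nonneg_nonneg r0)
  have bound: "\<bar>poly_eval g x - series_eval f x\<bar> \<le> ?M / \<rho> ^ Suc K * norm x ^ Suc K" if x: "norm x < \<rho>" for x
  proof -
    have xd: "x \<in> polydisc ?r" using x by (rule polydisc_const_if_small)
    have "((\<lambda>\<alpha>. ?h \<alpha> * monomial_at \<alpha> x + - (f \<alpha> * monomial_at \<alpha> x)) has_sum poly_eval g x + - series_eval f x) UNIV"
      unfolding poly_eval_eq_series_eval g
      by (intro has_sum_add has_sum_uminusI series_eval_has_sum[OF sm xd] series_eval_has_sum[OF smh xd])
    moreover have "((\<lambda>\<alpha>. (\<bar>f \<alpha>\<bar> * monomial_at \<alpha> ?r) * (norm x / \<rho>) ^ Suc K) has_sum ?M * (norm x / \<rho>) ^ Suc K) UNIV"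
      by (intro has_sum_cmult_left has_sum_infsum sm)
    ultimately have "norm (poly_eval g x + - series_eval f x) \<le> ?M * (norm x / \<rho>) ^ Suc K"
    proof (rule norm_infsum_le)
      fix \<alpha>
      show "norm (?h \<alpha> * monomial_at \<alpha> x + - (f \<alpha> * monomial_at \<alpha> x)) \<le> (\<bar>f \<alpha>\<bar> * monomial_at \<alpha> ?r) * (norm x / \<rho>) ^ Suc K"
      proof (cases "?deg \<alpha> \<le> K")
        case True
        then show ?thesis using r0[of \<alpha>] \<rho> by simp
      next
        case False
        then have "(norm x / \<rho>) ^ ?deg \<alpha> \<le> (norm x / \<rho>) ^ Suc K"
          using x \<rho> by (intro power_decreasing) auto
        then have "\<rho> ^ ?deg \<alpha> * (norm x / \<rho>) ^ ?deg \<alpha> \<le> monomial_at \<alpha> ?r * (norm x / \<rho>) ^ Suc K"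
          unfolding r using \<rho> by (intro mult_left_mono) auto
        moreover have "\<rho> ^ ?deg \<alpha> * (norm x / \<rho>) ^ ?deg \<alpha> = norm x ^ ?deg \<alpha>"
          using \<rho> by (simp add: power_divide)
        ultimately have "\<bar>monomial_at \<alpha> x\<bar> \<le> monomial_at \<alpha> ?r * (norm x / \<rho>) ^ Suc K"
          using abs_monomial_at_le_norm_power[of \<alpha> x] by linarith
        then have "\<bar>f \<alpha>\<bar> * \<bar>monomial_at \<alpha> x\<bar> \<le> \<bar>f \<alpha>\<bar> * (monomial_at \<alpha> ?r * (norm x / \<rho>) ^ Suc K)"
          by (rule mult_left_mono) simp
        then show ?thesis using False by (simp add: abs_mult mult.assoc del: power_Suc)
      qed
    qed
    then show ?thesis by (simp add: power_divide del: power_Suc)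
  qed
  show ?thesis
  proof (intro exI conjI)
    show "0 \<le> ?M / \<rho> ^ Suc K"
      using \<rho> by (intro divide_nonneg_nonneg infsum_nonneg mult_nonneg_nonneg r0) auto
    show "\<forall>\<^sub>F x in nhds 0. \<bar>poly_eval g x - series_eval f x\<bar> \<le> ?M / \<rho> ^ Suc K * norm x ^ Suc K"
      unfolding eventually_nhds_metric
      by (intro exI[of _ \<rho>] conjI allI impI \<rho> bound) (simp add: dist_norm)
  qed
qed

theorem lemma1p8:
  fixes f :: "'n::finite power_series"
  assumes "convergent_near_0 f"
    and "series_eval f 0 = 0"
    and "\<forall>\<^sub>F x in at 0. series_eval f x > 0"
  shows "\<exists>(K::nat) (g :: 'n polynomial). K > 0 \<and>
    poly_eval g \<asymp> series_eval f \<and>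
    series_eval f \<succsim> (\<lambda>x. norm x ^ K)"
proof -
  let ?f = "series_eval f"
  obtain K where K: "0 < K" "?f \<succsim> (\<lambda>x. norm x ^ K)"
    using lojasiewicz_isolated_zero[OF germ_series_eval[OF assms(1)] assms(2,3)] by blast
  then obtain c where c: "0 < c" "\<forall>\<^sub>F x in nhds 0. c * norm x ^ K \<le> ?f x"
    unfolding gtrsim_def by auto
  obtain g :: "'n polynomial" and C where C: "0 \<le> C"
    "\<forall>\<^sub>F x in nhds 0. \<bar>poly_eval g x - ?f x\<bar> \<le> C * norm x ^ Suc K"
    using taylor_polynomial_remainder[OF assms(1)] by blast
  have "((\<lambda>x. x) \<longlongrightarrow> (0 :: real ^ 'n)) (nhds 0)" by (rule filterlim_ident)
  from tendsto_mult_left[OF tendsto_norm[OF this], of C]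
have "\<forall>\<^sub>F x :: real ^ 'n in nhds 0. C * norm x < c / 2"
    by (rule order_tendstoD) (use c(1) in simp)
  with c(2) C(2) have near: "\<forall>\<^sub>F x in nhds 0. \<bar>poly_eval g x - ?f x\<bar> \<le> ?f x / 2"
  proof eventually_elim
    case (elim x)
    have "(C * norm x) * norm x ^ K \<le> (c / 2) * norm x ^ K"
      using elim(3) by (intro mult_right_mono) auto
    then show ?case using elim(1,2) by (simp add: mult.assoc)
  qed
  have "\<forall>\<^sub>F x in nhds 0. 2/3 * poly_eval g x \<le> ?f x \<and> ?f x \<le> 2 * poly_eval g x"
    using near by eventually_elim linarith
  then have "poly_eval g \<asymp> ?f"
    unfolding asymp_eq_def by (intro exI[of _ "2/3"] exI[of _ 2] conjI) auto
  with K show ?thesis by blast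
qed

end
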